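(* Let $m\ge n$, $1\le r\le n$, $\delta=r/n$, momentum $\mu\in[0,1)$, restart period $\tau\in\mathbb{Z}_{\ge1}$, number of nodes $N$ and horizon $T\ge1$. Suppose Assumptions (A1)–(A3) hold and let $\Delta F=f(\bm X_0)-\inf_{\bm X}f(\bm X)$. Then there is a choice of constant learning rate $\eta>0$ such that the iterates of PowerSGD+ with MSGD satisfy $$\frac1T\sum_{t=0}^{T-1}\mathbb{E}\big[\|\nabla f(\bm X_t)\|_F^2\big]\le\sqrt{\frac{32L\sigma^2\Delta F}{NT}}+\frac{8L\Delta F}{T}+\frac{6\sqrt[3]{274}\,(L\tau G\Delta F)^{2/3}}{T^{2/3}\delta^{2/3}(1-\mu)^{2/3}}.$$
   Context: Setting: $N$ nodes jointly minimize $f(\bm{X})=\frac1N\sum_{i=1}^N f_i(\bm{X})$ over $\bm{X}\in\mathbb{R}^{m\times n}$, where $f_i(\bm{X})=\mathbb{E}_{\xi^{(i)}\sim\mathcal{D}_i}[F(\bm{X};\xi^{(i)})]$; node $i$ queries stochastic gradients $\nabla F(\bm{X};\xi^{(i)})$, sampled independently across nodes and iterations. Assumptions: (A1) $f$ is bounded below and $L$-smooth ($\|\nabla f(\bm X)-\nabla f(\bm Y)\|_F\le L\|\bm X-\bm Y\|_F$). (A2) For each $i$, $\mathbb{E}[\nabla F(\bm{X};\xi^{(i)})]=\nabla f_i(\bm{X})$ and $\mathbb{E}\|\nabla F(\bm{X};\xi^{(i)})-\nabla f_i(\bm{X})\|_F^2\le\sigma^2$ for all $\bm X$. (A3) $\|\nabla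 f(\bm{X})\|_F^2\le\omega^2$ for all $\bm X$, and $\mathbb{E}\|\frac1N\sum_{i=1}^N\nabla F(\bm{X};\xi^{(i)})\|_F^2\le G^2:=\sigma^2+\omega^2$. $\mathrm{QR}(\bm A)$, for $\bm A\in\mathbb{R}^{m\times r}$, denotes the factor $\bm Q\in\mathbb{R}^{m\times r}$ with $\bm Q^\top\bm Q=I_r$ of an economic QR decomposition $\bm A=\bm Q\bm R$. PowerSGD+ with MSGD (step size $\eta$, momentum $\mu$, restart period $\tau$, rank $r$): initialize $\bm X_0\in\mathbb{R}^{m\times n}$, $\bm Q_{-1}\in\mathbb{R}^{n\times r}$, $\bm m_{-1}=0$, $\bm e_0^{(i)}=0$ for all $i$. For $t=0,\dots,T-1$: each node computes $\bm g_t^{(i)}=\nabla F(\bm X_t;\xi_t^{(i)})$ and $\bm\Delta_t^{(i)}=\bm g_t^{(i)}+\bm e_t^{(i)}$; let $\bm\Delta_t=\frac1N\sum_i\bm\Delta_t^{(i)}$. If $t\not\equiv0\pmod\tau$: $\tilde{\bm P}_t=\mathrm{QR}\big(\frac1N\sum_i\bm\Delta_t^{(i)}\bm Q_{t-1}\big)$; if $t\equiv0\pmod\tau$: $\tilde{\bm P}_t$ is the matrix of the first $r$ columns of $\bm U$ in an SVD $\bm\Delta_t=\bm U\bm\Sigma\bm V^\top$ (top-$r$ left singular vectors). In both cases $\bm Q_t=\frac1N\sum_i(\bm\Delta_t^{(i)})^\top\tilde{\bm P}_t$, $\widehat{\bm\Delta}_t^{(i)}=\tilde{\bm P}_t\tilde{\bm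 P}_t^\top\bm\Delta_t^{(i)}$, $\widehat{\bm\Delta}_t=\tilde{\bm P}_t\bm Q_t^\top$, $\bm e_{t+1}^{(i)}=\bm\Delta_t^{(i)}-\widehat{\bm\Delta}_t^{(i)}$, $\bm m_t=\mu\bm m_{t-1}+\widehat{\bm\Delta}_t$, $\bm X_{t+1}=\bm X_t-\eta\bm m_t$. *)

theory Defs
  imports "HOL-Probability.Probability"
begin

text \<open>Matrices in R^{m x n} are represented as real^'n^'m (rows indexed by 'm,
  columns by 'n); norm is then the Frobenius norm and inner product the
  Frobenius inner product.  Index types carry a well-order so that
  "first r columns" and "upper triangular" make sense.\<close>

definition idx :: "'a::{finite,wellorder} \<Rightarrow> nat" where
  "idx x = card {y. y < x}"

text \<open>Q is the Q-factor of an economic QR decomposition A = Q R (R upper triangular).\<close>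
definition is_econ_QR ::
  "real^('r::{finite,wellorder})^('m::{finite,wellorder}) \<Rightarrow> real^('r::{finite,wellorder})^('m::{finite,wellorder}) \<Rightarrow> bool" where
  "is_econ_QR A Q \<longleftrightarrow> transpose Q ** Q = mat 1 \<and>
     (\<exists>R. (\<forall>i j. j < i \<longrightarrow> R $ i $ j = 0) \<and> A = Q ** R)"

text \<open>P consists of the first r columns of U in an SVD A = U S V^T
  (singular values nonnegative, in nonincreasing order along the diagonal).\<close>
definition is_top_left_sv ::
  "real^('n::{finite,wellorder})^('m::{finite,wellorder}) \<Rightarrow> real^('r::{finite,wellorder})^('m::{finite,wellorder}) \<Rightarrow> bool" where
  "is_top_left_sv A P \<longleftrightarrow>
     (\<exists>(U::real^('m::{finite,wellorder})^('m::{finite,wellorder})) (S::real^('n::{finite,wellorder})^('m::{finite,wellorder})) (V::real^('n::{finite,wellorder})^('n::{finite,wellorder})).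
        orthogonal_matrix U \<and> orthogonal_matrix V \<and> A = U ** S ** transpose V \<and>
        (\<forall>i j. idx i \<noteq> idx j \<longrightarrow> S $ i $ j = 0) \<and>
        (\<forall>i j. 0 \<le> S $ i $ j) \<and>
        (\<forall>i j i' j'. idx i = idx j \<longrightarrow> idx i' = idx j' \<longrightarrow> idx i \<le> idx i'
            \<longrightarrow> S $ i' $ j' \<le> S $ i $ j) \<and>
        (\<forall>a k c. idx k = idx c \<longrightarrow> P $ a $ k = U $ a $ c))"

type_synonym ('n, 'm, 'r) pstate =
  "(real^'n^'m) \<times> (real^'r^'n) \<times> (real^'n^'m) \<times> (nat \<Rightarrow> real^'n^'m)"

text \<open>One iteration t of PowerSGD+ with MSGD. State (X_t, Q_{t-1}, m_{t-1}, e_t);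
  g i is the stochastic gradient of node i at X_t.\<close>
definition psgd_step ::
  "(real^'r^'m \<Rightarrow> real^'r^'m) \<Rightarrow> (real^'n^'m \<Rightarrow> real^'r^'m) \<Rightarrow> nat \<Rightarrow> real \<Rightarrow> real \<Rightarrow> nat
   \<Rightarrow> nat \<Rightarrow> (nat \<Rightarrow> real^'n^'m) \<Rightarrow> ('n, 'm, 'r) pstate \<Rightarrow> ('n, 'm, 'r) pstate" where
  "psgd_step qr svd \<tau> \<eta> \<mu> N t g s = (case s of (X, Q, mo, e) \<Rightarrow>
     let Di = (\<lambda>i. g i + e i);
         Dl = (1 / real N) *\<^sub>R (\<Sum>i<N. Di i);
         P = (if t mod \<tau> \<noteq> 0 then qr ((1 / real N) *\<^sub>R (\<Sum>i<N. Di i ** Q)) else svd Dl);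
         Qn = (1 / real N) *\<^sub>R (\<Sum>i<N. transpose (Di i) ** P);
         e' = (\<lambda>i. Di i - (P ** transpose P) ** Di i);
         mo' = \<mu> *\<^sub>R mo + P ** transpose Qn
     in (X - \<eta> *\<^sub>R mo', Qn, mo', e'))"

text \<open>State at iteration t for a realised sample path xs t i = xi_t^(i).\<close>
primrec psgd_state ::
  "(real^'r^'m \<Rightarrow> real^'r^'m) \<Rightarrow> (real^'n^'m \<Rightarrow> real^'r^'m) \<Rightarrow> nat \<Rightarrow> real \<Rightarrow> real \<Rightarrow> nat
   \<Rightarrow> (real^'n^'m \<Rightarrow> 'b \<Rightarrow> real^'n^'m) \<Rightarrow> real^'n^'m \<Rightarrow> real^'r^'n
   \<Rightarrow> (nat \<Rightarrow> nat \<Rightarrow> 'b) \<Rightarrow> nat \<Rightarrow> ('n, 'm, 'r) pstate" where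
  "psgd_state qr svd \<tau> \<eta> \<mu> N gF X0 Q0 xs 0 = (X0, Q0, 0, \<lambda>i. 0)"
| "psgd_state qr svd \<tau> \<eta> \<mu> N gF X0 Q0 xs (Suc t) =
     psgd_step qr svd \<tau> \<eta> \<mu> N t
       (\<lambda>i. gF (fst (psgd_state qr svd \<tau> \<eta> \<mu> N gF X0 Q0 xs t)) (xs t i))
       (psgd_state qr svd \<tau> \<eta> \<mu> N gF X0 Q0 xs t)"

text \<open>The iterate X_t.\<close>
definition psgd_X where
  "psgd_X qr svd \<tau> \<eta> \<mu> N gF X0 Q0 xs t = fst (psgd_state qr svd \<tau> \<eta> \<mu> N gF X0 Q0 xs t)"

end

theory Submission
  imports Defs
begin

lemma bounded_bilinear_matrix_mult:
  "bounded_bilinear ((**) :: real^'n^'m \<Rightarrow> real^'k^'n \<Rightarrow> real^'k^'m)"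
proof -
  have "bilinear ((**) :: real^'n^'m \<Rightarrow> real^'k^'n \<Rightarrow> real^'k^'m)"
    unfolding bilinear_def
    by (auto intro!: linearI simp: matrix_add_ldistrib matrix_scalar_ac scalar_matrix_assoc[symmetric])
      (simp_all add: matrix_matrix_mult_def vec_eq_iff sum.distrib algebra_simps)
  then show ?thesis
    by (simp add: bilinear_conv_bounded_bilinear)
qed

interpretation matrix_mult: bounded_bilinear "(**) :: real^'n^'m \<Rightarrow> real^'k^'n
  \<Rightarrow> real^'k^'m"
  by (rule bounded_bilinear_matrix_mult)

lemma bounded_linear_transpose: "bounded_linear (transpose :: real^'n^'m \<Rightarrow> real^'m^'n)"
  by (intro bounded_linearI' linearI) (simp_all add: transpose_def vec_eq_iff)

lemmas transpose_sum = linear_sum[OF bounded_linear.linear[OF bounded_linear_transpose]]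

lemma borel_measurable_matrix_mult [measurable (raw)]:
  fixes A :: "'a \<Rightarrow> real^'k^'m" and B :: "'a \<Rightarrow> real^'n^'k"
  assumes "A \<in> borel_measurable M" "B \<in> borel_measurable M"
  shows "(\<lambda>w. A w ** B w) \<in> borel_measurable M"
  using assms by (rule borel_measurable_continuous_Pair)
    (intro matrix_mult.continuous_on continuous_intros)

lemma borel_measurable_transpose [measurable (raw)]:
  fixes A :: "'a \<Rightarrow> real^'n^'m"
  assumes "A \<in> borel_measurable M"
  shows "(\<lambda>w. transpose (A w)) \<in> borel_measurable M"
  using borel_measurable_continuous_onI[OF linear_continuous_on[OF bounded_linear_transpose]] assms
  by (rule measurable_compose[rotated])

lemma inner_matrix_mult_left:
  fixes B :: "real^'k^'m" and C :: "real^'n^'k" and D :: "real^'n^'m"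
  shows "(B ** C) \<bullet> D = C \<bullet> (transpose B ** D)"
proof -
  have "(B ** C) \<bullet> D = (\<Sum>i\<in>UNIV. \<Sum>k\<in>UNIV. \<Sum>j\<in>UNIV. B$i$k * C$k$j
    * D$i$j)"
    by (simp add: inner_vec_def matrix_matrix_mult_def sum_distrib_right)
      (rule sum.cong[OF refl], rule sum.swap)
  also have "\<dots> = (\<Sum>k\<in>UNIV. \<Sum>j\<in>UNIV. \<Sum>i\<in>UNIV. B$i$k * C$k$j * D$i$j)"
    by (subst sum.swap) (rule sum.cong[OF refl], rule sum.swap)
  also have "\<dots> = C \<bullet> (transpose B ** D)"
    by (simp add: inner_vec_def matrix_matrix_mult_def transpose_def sum_distrib_left mult_ac)
  finally show ?thesis .
qed

lemma inner_matrix_mult_right: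
  fixes B :: "real^'n^'k" and C :: "real^'k^'m" and D :: "real^'n^'m"
  shows "(C ** B) \<bullet> D = C \<bullet> (D ** transpose B)"
proof -
  have "(C ** B) \<bullet> D = (\<Sum>i\<in>UNIV. \<Sum>k\<in>UNIV. \<Sum>j\<in>UNIV. C$i$k * B$k$j
    * D$i$j)"
    by (simp add: inner_vec_def matrix_matrix_mult_def sum_distrib_right)
      (rule sum.cong[OF refl], rule sum.swap)
  also have "\<dots> = C \<bullet> (D ** transpose B)"
    by (simp add: inner_vec_def matrix_matrix_mult_def transpose_def sum_distrib_left mult_ac)
  finally show ?thesis .
qed

lemma norm_orthogonal_matrix_mult:
  fixes U :: "real^'m^'m" and V :: "real^'n^'n" and B :: "real^'n^'m"
  assumes U: "orthogonal_matrix U" and V: "orthogonal_matrix V"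
  shows "norm (U ** B ** transpose V) = norm B"
proof -
  have "transpose U ** (U ** (B ** transpose V)) = B ** transpose V"
    using U by (simp only: matrix_mul_assoc orthogonal_matrix matrix_mul_lid)
  then have "(U ** (B ** transpose V)) \<bullet> (U ** (B ** transpose V)) = (B ** transpose V)
    \<bullet> (B ** transpose V)"
    by (simp only: inner_matrix_mult_left[of U])
  also have "\<dots> = B \<bullet> (B ** transpose V ** V)"
    by (simp only: inner_matrix_mult_right[where B="transpose V"] transpose_transpose)
  also have "B ** transpose V ** V = B"
    using V by (simp only: orthogonal_matrix matrix_mul_assoc[symmetric] matrix_mul_rid)
  finally show ?thesis
    by (simp add: norm_eq_sqrt_inner matrix_mul_assoc)
qed

lemma norm_projector_Pythagoras:
  fixes P :: "real^'r^'m" and A :: "real^'n^'m"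
  assumes "transpose P ** P = mat 1"
  shows "(norm (P ** transpose P ** A))\<^sup>2 + (norm (A - P ** transpose P ** A))\<^sup>2
    = (norm A)\<^sup>2"
proof -
  let ?B = "transpose P ** A"
  have "transpose P ** (P ** ?B) = ?B"
    using assms by (simp only: matrix_mul_assoc matrix_mul_lid)
  then have "(P ** ?B) \<bullet> (P ** ?B) = (P ** ?B) \<bullet> A"
    by (simp only: inner_matrix_mult_left[of P])
  then have "orthogonal (P ** ?B) (A - P ** ?B)"
    by (simp add: orthogonal_def inner_diff_right)
  from norm_add_Pythagorean[OF this] show ?thesis
    by (simp add: matrix_mul_assoc)
qed

lemma idx_less_iff:
  fixes x y :: "'a::{finite,wellorder}"
  shows "idx x < idx y \<longleftrightarrow> x < y"
proof
  assume "x < y"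
  then have "{z. z < x} \<subset> {z. z < y}"
    by auto
  then show "idx x < idx y"
    unfolding idx_def by (intro psubset_card_mono) auto
next
  assume "idx x < idx y"
  then have "\<not> {z. z < y} \<subseteq> {z. z < x}"
    unfolding idx_def using card_mono[of "{z. z < x}" "{z. z < y}"] by auto
  then show "x < y"
    by (auto intro: order.strict_trans)
qed

lemma inj_idx: "inj (idx :: 'a::{finite,wellorder} \<Rightarrow> nat)"
  by (rule injI) (metis idx_less_iff less_irrefl neqE)

lemma idx_eq_iff [simp]: "idx x = idx y \<longleftrightarrow> x = (y :: 'a::{finite,wellorder})"
  using inj_idx by (auto dest: injD)

lemma idx_less_card: "idx (x :: 'a::{finite,wellorder}) < CARD('a)"
  unfolding idx_def by (intro psubset_card_mono) auto

lemma bij_betw_idx: "bij_betw (idx :: 'a::{finite,wellorder} \<Rightarrow> nat) UNIV {..<CARD('a)}"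
proof -
  have "idx ` (UNIV :: 'a set) = {..<CARD('a)}"
    using idx_less_card card_image[OF inj_idx]
    by (intro card_subset_eq) (auto simp: card_image[OF inj_idx])
  then show ?thesis
    using inj_idx by (simp add: bij_betw_def)
qed

lemma ex_idx_eq:
  assumes "k < CARD('a)"
  obtains x :: "'a::{finite,wellorder}" where "idx x = k"
proof -
  have "k \<in> idx ` (UNIV :: 'a set)"
    using assms bij_betw_idx[where 'a='a] by (simp add: bij_betw_def)
  then show thesis
    using that by blast
qed

lemma ex_idx_eq_idx:
  fixes x :: "'a::{finite,wellorder}"
  assumes "CARD('a::{finite,wellorder}) \<le> CARD('b::{finite,wellorder})"
  obtains y :: "'b::{finite,wellorder}" where "idx y = idx x"
proof -
  have "idx x < CARD('b)"
    using idx_less_card[of x] assms by linarith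
  then obtain y :: 'b where "idx y = idx x"
    by (rule ex_idx_eq)
  then show thesis
    by (rule that)
qed

lemma norm_vec_power2:
  fixes x :: "'a::real_inner^'n"
  shows "(norm x)\<^sup>2 = (\<Sum>i\<in>UNIV. (norm (x $ i))\<^sup>2)"
  by (simp add: power2_norm_eq_inner inner_vec_def)

lemma sum_over_idx: "(\<Sum>x\<in>(UNIV :: 'a::{finite,wellorder} set). g (idx x))
  = (\<Sum>k<CARD('a). g k)"
  by (rule sum.reindex_bij_betw[OF bij_betw_idx])

text \<open>The mean of the \<open>n - r\<close> smallest of \<open>n\<close> numbers is at most the mean of all of them.\<close>

lemma sum_tail_le_if_nonincreasing:
  fixes t :: "nat \<Rightarrow> real"
  assumes mono: "\<And>k k'. k \<le> k' \<Longrightarrow> k' < n \<Longrightarrow> t k' \<le> t k"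
    and "0 < r" "r \<le> n"
  shows "(\<Sum>k\<in>{r..<n}. t k) \<le> (1 - real r / real n) * (\<Sum>k<n. t k)"
proof -
  define A where "A = (\<Sum>k<r. t k)"
  define B where "B = (\<Sum>k\<in>{r..<n}. t k)"
  have "real r * t (r - 1) \<le> A"
    unfolding A_def using sum_bounded_below[of "{..<r}" "t (r - 1)" t] mono assms by auto
  moreover have "B \<le> of_nat (card {r..<n}) * t (r - 1)"
    unfolding B_def by (rule sum_bounded_above) (use mono[of "r - 1"] in auto)
  ultimately have "real r * B \<le> real (n - r) * A"
    by (smt (verit) card_atLeastLessThan mult.left_commute mult_left_mono of_nat_0_le_iff)
  moreover have "(\<Sum>k<n. t k) = A + B"
    unfolding A_def B_def using assms by (metis lessThan_atLeast0 sum.atLeastLessThan_concat zero_le)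
  ultimately show ?thesis
    using assms by (simp add: B_def field_simps)
qed

definition first_columns :: "real^('r::{finite,wellorder})^('m::{finite,wellorder})" where
  "first_columns = (\<chi> c k. if idx c = idx k then 1 else 0)"

lemma matrix_mult_first_columns:
  fixes U :: "real^('m::{finite,wellorder})^'k" and k :: "'r::{finite,wellorder}"
  assumes "idx c = idx k"
  shows "(U ** first_columns) $ a $ k = U $ a $ c"
proof -
  have "z * first_columns $ c' $ k = (if c' = c then z else 0)" for c' z
    using assms[symmetric] by (simp add: first_columns_def)
  then show ?thesis
    by (simp add: matrix_matrix_mult_def)
qed

lemma first_columns_orthonormal:
  assumes "CARD('r::{finite,wellorder}) \<le> CARD('m::{finite,wellorder})"
  shows "transpose first_columns ** (first_columns ::
    real^('r::{finite,wellorder})^('m::{finite,wellorder})) = mat 1"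
proof -
  have "(transpose first_columns ** (first_columns ::
    real^('r::{finite,wellorder})^('m::{finite,wellorder}))) $ k $ k' = mat 1 $ k $ k'" for k k'
  proof -
    obtain c :: "'m::{finite,wellorder}" where c: "idx c = idx k'"
      using assms by (rule ex_idx_eq_idx)
    have "(transpose first_columns ** (first_columns ::
      real^('r::{finite,wellorder})^('m::{finite,wellorder}))) $ k $ k' = first_columns $ c $ k"
      using matrix_mult_first_columns[OF c, of "transpose first_columns" k]
      by (simp add: transpose_def)
    then show ?thesis
      using c by (simp add: first_columns_def mat_def)
  qed
  then show ?thesis
    by (simp add: vec_eq_iff)
qed

lemma first_columns_projector:
  assumes "CARD('r::{finite,wellorder}) \<le> CARD('m::{finite,wellorder})"
  shows "(first_columns :: real^('r::{finite,wellorder})^('m::{finite,wellorder}))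
    ** transpose first_columns ** S
    = (\<chi> c. if idx c < CARD('r::{finite,wellorder}) then S $ c else 0)"
proof -
  have EE: "((first_columns :: real^('r::{finite,wellorder})^('m::{finite,wellorder}))
    ** transpose first_columns) $ c $ c' * y
      = (if c' = c \<and> idx c < CARD('r::{finite,wellorder}) then y else 0)" for c c' y
  proof (cases "idx c < CARD('r::{finite,wellorder})")
    case True
    then obtain k0 :: "'r::{finite,wellorder}" where k0: "idx k0 = idx c"
      by (rule ex_idx_eq)
    have "(first_columns :: real^('r::{finite,wellorder})^('m::{finite,wellorder})) $ c $ k * z
        = (if k = k0 then z else 0)" for k z
      using k0[symmetric] by (simp add: first_columns_def)
    then have "((first_columns :: real^('r::{finite,wellorder})^('m::{finite,wellorder}))
      ** transpose first_columns) $ c $ c'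
        = first_columns $ c' $ k0"
      unfolding matrix_matrix_mult_def transpose_def by simp
    then show ?thesis
      using True k0 by (auto simp: first_columns_def)
  next
    case False
    have "idx c \<noteq> idx k" for k :: "'r::{finite,wellorder}"
      using False idx_less_card[of k] by auto
    then show ?thesis
      using False by (simp add: matrix_matrix_mult_def first_columns_def transpose_def)
  qed
  have "((first_columns :: real^('r::{finite,wellorder})^('m::{finite,wellorder}))
    ** transpose first_columns ** S) $ c $ j
      = (if idx c < CARD('r::{finite,wellorder}) then S $ c $ j else 0)" for c j
    by (cases "idx c < CARD('r::{finite,wellorder})") (simp_all add: matrix_matrix_mult_def[of _ S] EE)
  then show ?thesis
    by (simp add: vec_eq_iff)
qed

text \<open>Row \<open>c\<close> of the singular value matrix carries only the singular value with index \<open>idx c\<close>.\<close>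

lemma is_top_left_svE:
  fixes A :: "real^('n::{finite,wellorder})^('m::{finite,wellorder})"
    and P :: "real^('r::{finite,wellorder})^('m::{finite,wellorder})"
  assumes "is_top_left_sv A P" and "CARD('r::{finite,wellorder}) \<le> CARD('m::{finite,wellorder})"
  obtains U S V where "orthogonal_matrix U" "orthogonal_matrix V" "A = U ** S ** transpose V"
    "P = U ** first_columns" "\<And>c. CARD('n::{finite,wellorder}) \<le> idx c \<Longrightarrow> S $ c = 0"
    "\<And>c c'. idx c \<le> idx c' \<Longrightarrow> norm (S $ c') \<le> norm (S $ c)"
proof -
  obtain U :: "real^('m::{finite,wellorder})^('m::{finite,wellorder})"
    and S :: "real^('n::{finite,wellorder})^('m::{finite,wellorder})"
    and V :: "real^('n::{finite,wellorder})^('n::{finite,wellorder})" where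
    UV: "orthogonal_matrix U" "orthogonal_matrix V" "A = U ** S ** transpose V"
    and diag: "\<And>i j. idx i \<noteq> idx j \<Longrightarrow> S $ i $ j = 0"
    and nonneg: "\<And>i j. 0 \<le> S $ i $ j"
    and sorted: "\<And>i j i' j'. idx i = idx j \<Longrightarrow> idx i' = idx j'
      \<Longrightarrow> idx i \<le> idx i'
      \<Longrightarrow> S $ i' $ j' \<le> S $ i $ j"
    and cols: "\<And>a k c. idx k = idx c \<Longrightarrow> P $ a $ k = U $ a $ c"
    using assms(1) unfolding is_top_left_sv_def by blast
  have "P = U ** first_columns"
  proof -
    have "P $ a $ k = (U ** first_columns) $ a $ k" for a k
    proof -
      obtain c :: "'m::{finite,wellorder}" where "idx c = idx k"
        using assms(2) by (rule ex_idx_eq_idx)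
      then show ?thesis
        using cols matrix_mult_first_columns by metis
    qed
    then show ?thesis
      by (simp add: vec_eq_iff)
  qed
  moreover have row_zero: "S $ c = 0" if "CARD('n::{finite,wellorder}) \<le> idx c" for c
  proof -
    have "idx c \<noteq> idx j" for j :: "'n::{finite,wellorder}"
      using that idx_less_card[of j] by linarith
    then show ?thesis
      using diag by (simp add: vec_eq_iff)
  qed
  moreover have "norm (S $ c') \<le> norm (S $ c)" if "idx c \<le> idx c'" for c c'
  proof (cases "idx c' < CARD('n::{finite,wellorder})")
    case True
    have "idx c < CARD('n::{finite,wellorder})"
      using True that by linarith
    then obtain j :: "'n::{finite,wellorder}" where j: "idx j = idx c"
      by (rule ex_idx_eq)
    obtain j' :: "'n::{finite,wellorder}" where j': "idx j' = idx c'"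
      using True by (rule ex_idx_eq)
    have row: "norm (S $ i) = S $ i $ l" if il: "idx l = idx i" for i l
    proof -
      have "S $ i $ j' = 0" if "j' \<noteq> l" for j'
        using diag[of i j'] il that by (metis idx_eq_iff)
      then have "S $ i = S $ i $ l *\<^sub>R axis l 1"
        by (auto simp: vec_eq_iff axis_def)
      then show ?thesis
        using nonneg[of i l] by (metis norm_axis_1 norm_scaleR abs_of_nonneg mult_1_right)
    qed
    show ?thesis
      using sorted[OF j[symmetric] j'[symmetric]] that row[OF j] row[OF j'] by simp
  next
    case False
    then show ?thesis
      using row_zero by simp
  qed
  ultimately show ?thesis
    using UV that by blast
qed

lemma is_top_left_sv_orthonormal:
  assumes "is_top_left_sv A P" and "CARD('r::{finite,wellorder}) \<le> CARD('m::{finite,wellorder})"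
  shows "transpose P ** (P :: real^('r::{finite,wellorder})^('m::{finite,wellorder})) = mat 1"
proof -
  obtain U where "orthogonal_matrix U" "P = U ** first_columns"
    using is_top_left_svE[OF assms] by metis
  then show ?thesis
    using first_columns_orthonormal[OF assms(2)]
    by (simp add: matrix_transpose_mul matrix_mul_assoc orthogonal_matrix)
      (simp add: matrix_mul_assoc[symmetric])
qed

text \<open>Projecting onto the top \<open>r\<close> left singular vectors keeps the \<open>r\<close> largest of the
  \<open>n\<close> squared singular values, hence at least the fraction \<open>r
    / n\<close> of \<open>\<parallel>A\<parallel>\<^sup>2\<close>.\<close>

lemma is_top_left_sv_residual:
  fixes A :: "real^('n::{finite,wellorder})^('m::{finite,wellorder})"
    and P :: "real^('r::{finite,wellorder})^('m::{finite,wellorder})"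
  assumes "is_top_left_sv A P" and "1 \<le> CARD('r::{finite,wellorder})" "CARD('r::{finite,wellorder})
    \<le> CARD('n::{finite,wellorder})" "CARD('n::{finite,wellorder}) \<le> CARD('m::{finite,wellorder})"
  shows "(norm (A - P ** transpose P ** A))\<^sup>2
    \<le> (1 - real CARD('r::{finite,wellorder}) / real CARD('n::{finite,wellorder})) * (norm A)\<^sup>2"
proof -
  have rm: "CARD('r::{finite,wellorder}) \<le> CARD('m::{finite,wellorder})"
    using assms by simp
  obtain U S V where U: "orthogonal_matrix U" and V: "orthogonal_matrix V"
    and A: "A = U ** S ** transpose V" and P: "P = U ** first_columns"
    and zero: "\<And>c. CARD('n::{finite,wellorder}) \<le> idx c \<Longrightarrow> S $ c = 0"
    and sorted: "\<And>c c'. idx c \<le> idx c' \<Longrightarrow> norm (S $ c') \<le> norm (S $ c)"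
    using is_top_left_svE[OF assms(1) rm] by metis
  define R where "R = (\<chi> c. if idx c < CARD('r::{finite,wellorder}) then 0 else S $ c)"
  define t where "t k = (norm (S $ inv idx k))\<^sup>2" for k
  have t: "(norm (S $ c))\<^sup>2 = t (idx c)" for c
    by (simp add: t_def inv_f_f[OF inj_idx])
  have idx_inv: "idx (inv idx k :: 'm::{finite,wellorder}) = k" if "k < CARD('m::{finite,wellorder})" for k
    using that bij_betw_idx[where 'a="'m::{finite,wellorder}"] by (simp add: bij_betw_def f_inv_into_f)
  have t_mono: "t k' \<le> t k" if "k \<le> k'" "k' < CARD('n::{finite,wellorder})" for k k'
    using sorted[of "inv idx k" "inv idx k'"] idx_inv[of k] idx_inv[of k'] that assms
    unfolding t_def by (auto intro!: power_mono)
  have t_zero: "t k = 0" if "CARD('n::{finite,wellorder}) \<le> k" "k < CARD('m::{finite,wellorder})" for k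
    using zero[of "inv idx k"] idx_inv[of k] that by (simp add: t_def)
  define E :: "real^('r::{finite,wellorder})^('m::{finite,wellorder})" where "E = first_columns"
  have "P ** transpose P ** A = U ** E ** transpose E ** (transpose U ** U) ** S ** transpose V"
    by (simp add: A P E_def matrix_transpose_mul matrix_mul_assoc)
  also have "\<dots> = U ** (E ** transpose E ** S) ** transpose V"
    using U by (simp add: orthogonal_matrix) (simp add: matrix_mul_assoc)
  finally have proj: "P ** transpose P ** A = U ** (E ** transpose E ** S) ** transpose V" .
  have "R = S - E ** transpose E ** S"
    by (simp add: R_def first_columns_projector[OF rm, folded E_def] vec_eq_iff)
  then have "A - P ** transpose P ** A = U ** R ** transpose V"
    unfolding proj by (simp add: A matrix_mult.diff_left matrix_mult.diff_right)
  then have "(norm (A - P ** transpose P ** A))\<^sup>2 = (\<Sum>c\<in>UNIV. (norm (R $ c))\<^sup>2)"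
    by (simp add: norm_orthogonal_matrix_mult[OF U V] norm_vec_power2[of R])
  also have "\<dots> = (\<Sum>k<CARD('m::{finite,wellorder}). if k < CARD('r::{finite,wellorder}) then 0
    else t k)"
    unfolding sum_over_idx[symmetric] by (intro sum.cong) (auto simp: R_def t)
  also have "\<dots> = (\<Sum>k\<in>{CARD('r::{finite,wellorder})..<CARD('n::{finite,wellorder})}. t k)"
    using assms t_zero by (intro sum.mono_neutral_cong_right) auto
  also have "\<dots> \<le> (1 - real CARD('r::{finite,wellorder}) / real CARD('n::{finite,wellorder}))
    * (\<Sum>k<CARD('n::{finite,wellorder}). t k)"
    using assms by (intro sum_tail_le_if_nonincreasing t_mono) auto
  also have "(\<Sum>k<CARD('n::{finite,wellorder}). t k) = (\<Sum>k<CARD('m::{finite,wellorder}). t k)"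
    using assms t_zero by (intro sum.mono_neutral_cong_left) auto
  also have "\<dots> = (norm S)\<^sup>2"
    by (simp add: norm_vec_power2[of S] t flip: sum_over_idx)
  also have "\<dots> = (norm A)\<^sup>2"
    by (simp add: A norm_orthogonal_matrix_mult[OF U V])
  finally show ?thesis .
qed

locale powersgd =
  fixes qr :: "real^('r::{finite,wellorder})^('m::{finite,wellorder})
      \<Rightarrow> real^('r::{finite,wellorder})^('m::{finite,wellorder})"
    and svd :: "real^('n::{finite,wellorder})^('m::{finite,wellorder})
      \<Rightarrow> real^('r::{finite,wellorder})^('m::{finite,wellorder})"
    and \<tau> :: nat and \<eta> \<mu> :: real and N :: nat
    and gF :: "real^('n::{finite,wellorder})^('m::{finite,wellorder}) \<Rightarrow> 'b
      \<Rightarrow> real^('n::{finite,wellorder})^('m::{finite,wellorder})"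
    and X0 :: "real^('n::{finite,wellorder})^('m::{finite,wellorder})"
    and Q0 :: "real^('r::{finite,wellorder})^('n::{finite,wellorder})"
  assumes qr: "\<And>A. is_econ_QR A (qr A)" and svd: "\<And>A. is_top_left_sv A (svd A)"
    and rank: "1 \<le> CARD('r::{finite,wellorder})" "CARD('r::{finite,wellorder})
      \<le> CARD('n::{finite,wellorder})"
      "CARD('n::{finite,wellorder}) \<le> CARD('m::{finite,wellorder})"
    and momentum_factor: "0 \<le> \<mu>" "\<mu> < 1"
    and period: "1 \<le> \<tau>"
begin

text \<open>For a sample path \<open>xs\<close>, the state at time \<open>t\<close> is \<open>(X\<^sub>t, Q\<^sub>t\<^sub>-\<^sub>1, m\<^sub>t\<^sub>-\<^sub>1, e\<^sub>t)\<close>.\<close>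

abbreviation state where "state xs t \<equiv> psgd_state qr svd \<tau> \<eta> \<mu> N gF X0 Q0 xs t"

definition iterate where "iterate xs t = fst (state xs t)"
definition prev_Q where "prev_Q xs t = fst (snd (state xs t))"
definition momentum where "momentum xs t = fst (snd (snd (state xs t)))"
definition error where "error xs t = snd (snd (snd (state xs t)))"

definition corrected where "corrected xs t i = gF (iterate xs t) (xs t i) + error xs t i"
definition basis where
  "basis xs t = (if t mod \<tau> \<noteq> 0 then qr
    ((1 / real N) *\<^sub>R (\<Sum>i<N. corrected xs t i ** prev_Q xs t))
     else svd ((1 / real N) *\<^sub>R (\<Sum>i<N. corrected xs t i)))"
definition projector where "projector xs t = basis xs t ** transpose (basis xs t)"

definition stoch_grad where "stoch_grad xs t = (1 / real N) *\<^sub>R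
  (\<Sum>i<N. gF (iterate xs t) (xs t i))"
definition avg_error where "avg_error xs t = (1 / real N) *\<^sub>R (\<Sum>i<N. error xs t i)"

lemma psgd_X_eq_iterate: "psgd_X qr svd \<tau> \<eta> \<mu> N gF X0 Q0 xs t = iterate xs t"
  by (simp add: psgd_X_def iterate_def)

lemma state_0: "iterate xs 0 = X0" "prev_Q xs 0 = Q0" "momentum xs 0 = 0" "error xs 0 = (\<lambda>i. 0)"
  by (simp_all add: iterate_def prev_Q_def momentum_def error_def)

lemma state_Suc:
  "prev_Q xs (Suc t) = (1 / real N) *\<^sub>R (\<Sum>i<N. transpose (corrected xs t i) ** basis xs t)"
  "momentum xs (Suc t) = \<mu> *\<^sub>R momentum xs t + basis xs t ** transpose (prev_Q xs (Suc t))"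
  "iterate xs (Suc t) = iterate xs t - \<eta> *\<^sub>R momentum xs (Suc t)"
  "error xs (Suc t) i = corrected xs t i - projector xs t ** corrected xs t i"
proof -
  have "state xs t = (iterate xs t, prev_Q xs t, momentum xs t, error xs t)"
    by (simp add: iterate_def prev_Q_def momentum_def error_def)
  moreover have "state xs (Suc t)
      = psgd_step qr svd \<tau> \<eta> \<mu> N t (\<lambda>i. gF (iterate xs t) (xs t i)) (state xs t)"
    by (simp add: iterate_def)
  ultimately have "state xs (Suc t) =
     (let Q' = (1 / real N) *\<^sub>R (\<Sum>i<N. transpose (corrected xs t i) ** basis xs t);
          m' = \<mu> *\<^sub>R momentum xs t + basis xs t ** transpose Q'
      in (iterate xs t - \<eta> *\<^sub>R m', Q', m', \<lambda>i. corrected xs t i - projector xs t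
        ** corrected xs t i))"
    unfolding psgd_step_def by (simp add: Let_def corrected_def basis_def projector_def)
  then show
    "prev_Q xs (Suc t) = (1 / real N) *\<^sub>R (\<Sum>i<N. transpose (corrected xs t i) ** basis xs t)"
    "momentum xs (Suc t) = \<mu> *\<^sub>R momentum xs t + basis xs t ** transpose (prev_Q xs (Suc t))"
    "iterate xs (Suc t) = iterate xs t - \<eta> *\<^sub>R momentum xs (Suc t)"
    "error xs (Suc t) i = corrected xs t i - projector xs t ** corrected xs t i"
    by (simp_all add: iterate_def prev_Q_def momentum_def error_def Let_def)
qed

lemma state_eq_if_same_history:
  assumes "\<And>s i. s < t \<Longrightarrow> i < N \<Longrightarrow> xs s i = xs' s i"
  shows "iterate xs t = iterate xs' t \<and> prev_Q xs t = prev_Q xs' t \<and> momentum xs t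
    = momentum xs' t
    \<and> (\<forall>i<N. error xs t i = error xs' t i)"
  using assms
proof (induction t)
  case 0
  then show ?case
    by (simp add: state_0)
next
  case (Suc t)
  then have IH: "iterate xs t = iterate xs' t" "prev_Q xs t = prev_Q xs' t"
    "momentum xs t = momentum xs' t" "\<And>i. i < N \<Longrightarrow> error xs t i = error xs' t i"
    by auto
  have corrected: "\<And>i. i < N \<Longrightarrow> corrected xs t i = corrected xs' t i"
    using IH Suc.prems by (simp add: corrected_def)
  have "(\<Sum>i<N. corrected xs t i) = (\<Sum>i<N. corrected xs' t i)"
    "(\<Sum>i<N. corrected xs t i ** prev_Q xs t) = (\<Sum>i<N. corrected xs' t i ** prev_Q xs' t)"
    using corrected IH(2) by (auto intro: sum.cong)
  then have "basis xs t = basis xs' t"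
    unfolding basis_def by simp
  moreover have "prev_Q xs (Suc t) = prev_Q xs' (Suc t)"
    unfolding state_Suc(1) \<open>basis xs t = basis xs' t\<close> using corrected by (auto intro: sum.cong)
  ultimately show ?case
    using IH corrected by (simp add: state_Suc projector_def)
qed

lemma state_measurable:
  fixes xs :: "'w \<Rightarrow> nat \<Rightarrow> nat \<Rightarrow> 'b"
  assumes gF: "\<And>i. i < N \<Longrightarrow> (\<lambda>(X, z). gF X z)
    \<in> borel_measurable (borel \<Otimes>\<^sub>M D i)"
    and qr: "qr \<in> borel_measurable borel" and svd: "svd \<in> borel_measurable borel"
    and xs: "\<And>s i. s < t \<Longrightarrow> i < N \<Longrightarrow> (\<lambda>w. xs w s i)
      \<in> measurable \<Omega> (D i)"
  shows "(\<lambda>w. iterate (xs w) t) \<in> borel_measurable \<Omega>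
    \<and> (\<lambda>w. prev_Q (xs w) t) \<in> borel_measurable \<Omega>
    \<and> (\<lambda>w. momentum (xs w) t) \<in> borel_measurable \<Omega>
    \<and> (\<forall>i<N. (\<lambda>w. error (xs w) t i) \<in> borel_measurable \<Omega>)"
  using xs
proof (induction t)
  case 0
  then show ?case
    by (simp add: state_0)
next
  case (Suc t)
  then have IH: "(\<lambda>w. iterate (xs w) t)
    \<in> borel_measurable \<Omega>" "(\<lambda>w. prev_Q (xs w) t) \<in> borel_measurable \<Omega>"
    "(\<lambda>w. momentum (xs w) t) \<in> borel_measurable \<Omega>"
    "\<And>i. i < N \<Longrightarrow> (\<lambda>w. error (xs w) t i) \<in> borel_measurable \<Omega>"
    by auto
  have corrected: "(\<lambda>w. corrected (xs w) t i) \<in> borel_measurable \<Omega>" if "i < N" for i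
  proof -
    have "(\<lambda>w. (iterate (xs w) t, xs w t i))
      \<in> measurable \<Omega> (borel \<Otimes>\<^sub>M D i)"
      using IH(1) Suc.prems[of t i] that by measurable
    from measurable_compose[OF this gF[OF that]]
    have "(\<lambda>w. gF (iterate (xs w) t) (xs w t i)) \<in> borel_measurable \<Omega>"
      by simp
    then show ?thesis
      unfolding corrected_def using IH(4)[OF that] by (rule borel_measurable_add)
  qed
  have basis: "(\<lambda>w. basis (xs w) t) \<in> borel_measurable \<Omega>"
  proof -
    have "(\<lambda>w. qr ((1 / real N) *\<^sub>R (\<Sum>i<N. corrected (xs w) t i ** prev_Q (xs w) t)))
      \<in> borel_measurable \<Omega>"
      using measurable_compose[OF _ qr] corrected IH(2) by measurable
    moreover have "(\<lambda>w. svd ((1 / real N) *\<^sub>R (\<Sum>i<N. corrected (xs w) t i)))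
      \<in> borel_measurable \<Omega>"
      using measurable_compose[OF _ svd] corrected by measurable
    ultimately show ?thesis
      unfolding basis_def by (cases "t mod \<tau> = 0") simp_all
  qed
  have Q: "(\<lambda>w. prev_Q (xs w) (Suc t)) \<in> borel_measurable \<Omega>"
    unfolding state_Suc using corrected basis by measurable
  have m: "(\<lambda>w. momentum (xs w) (Suc t)) \<in> borel_measurable \<Omega>"
    unfolding state_Suc(2) using Q basis IH(3) by measurable
  have "(\<lambda>w. iterate (xs w) (Suc t)) \<in> borel_measurable \<Omega>"
    unfolding state_Suc(3) using m IH(1) by measurable
  moreover have "(\<lambda>w. error (xs w) (Suc t) i) \<in> borel_measurable \<Omega>" if "i < N" for i
    unfolding state_Suc(4) projector_def using basis corrected[OF that] by measurable
  ultimately show ?case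
    using Q m by blast
qed

end

definition total_lag_weight :: "nat \<Rightarrow> real \<Rightarrow> real \<Rightarrow> real" where
  "total_lag_weight \<tau> \<delta> \<mu> = (1 + real \<tau> / (1 - sqrt (1 - \<delta>))) / (1 - \<mu>)"

lemma power2_weighted_sum_le:
  fixes w a :: "'a \<Rightarrow> real"
  assumes "\<And>s. s \<in> S \<Longrightarrow> 0 \<le> w s"
  shows "(\<Sum>s\<in>S. w s * a s)\<^sup>2 \<le> (\<Sum>s\<in>S. w s)
    * (\<Sum>s\<in>S. w s * (a s)\<^sup>2)"
proof -
  have "(\<Sum>s\<in>S. w s * a s)\<^sup>2 = (\<Sum>s\<in>S. sqrt (w s) * (sqrt (w s) * a s))\<^sup>2"
    using assms by (simp add: mult.assoc[symmetric])
  also have "\<dots> \<le> (\<Sum>s\<in>S. (sqrt (w s))\<^sup>2)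
    * (\<Sum>s\<in>S. (sqrt (w s) * a s)\<^sup>2)"
    by (rule Cauchy_Schwarz_ineq_sum)
  also have "\<dots> = (\<Sum>s\<in>S. w s) * (\<Sum>s\<in>S. w s * (a s)\<^sup>2)"
    using assms by (simp add: power_mult_distrib)
  finally show ?thesis .
qed

context powersgd
begin

lemma avg_corrected: "(1 / real N) *\<^sub>R (\<Sum>i<N. corrected xs t i) = stoch_grad xs t
  + avg_error xs t"
  by (simp add: corrected_def stoch_grad_def avg_error_def sum.distrib scaleR_add_right)

lemma momentum_Suc_avg:
  "momentum xs (Suc t) = \<mu> *\<^sub>R momentum xs t + projector xs t
    ** (stoch_grad xs t + avg_error xs t)"
proof -
  have "basis xs t ** transpose (prev_Q xs (Suc t))
    = (1 / real N) *\<^sub>R (\<Sum>i<N. projector xs t ** corrected xs t i)"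
    by (simp add: state_Suc(1) transpose_scalar transpose_sum matrix_transpose_mul matrix_mult.scaleR_right
        matrix_mult.sum_right projector_def matrix_mul_assoc)
  also have "\<dots> = projector xs t ** (stoch_grad xs t + avg_error xs t)"
    by (simp add: avg_corrected[symmetric] matrix_mult.scaleR_right matrix_mult.sum_right)
  finally show ?thesis
    by (simp add: state_Suc(2))
qed

lemma avg_error_Suc:
  "avg_error xs (Suc t) = (stoch_grad xs t + avg_error xs t) - projector xs t
    ** (stoch_grad xs t + avg_error xs t)"
proof -
  have "avg_error xs (Suc t) = (1 / real N) *\<^sub>R (\<Sum>i<N. corrected xs t i)
      - projector xs t ** ((1 / real N) *\<^sub>R (\<Sum>i<N. corrected xs t i))"
    unfolding avg_error_def state_Suc(4) sum_subtractf scaleR_diff_right matrix_mult.scaleR_right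
      matrix_mult.sum_right ..
  then show ?thesis
    by (simp only: avg_corrected)
qed

text \<open>The virtual sequence \<open>Z\<^sub>t\<close> of the error-feedback analysis: with \<open>\<eta> = \<gamma> (1 - \<mu>)\<close> it takes
  plain SGD steps with the averaged stochastic gradient.\<close>

definition virtual where
  "virtual \<gamma> xs t = iterate xs t - (\<gamma> * \<mu>) *\<^sub>R momentum xs t
    - \<gamma> *\<^sub>R avg_error xs t"

lemma virtual_Suc:
  assumes "\<eta> = \<gamma> * (1 - \<mu>)"
  shows "virtual \<gamma> xs (Suc t) = virtual \<gamma> xs t - \<gamma> *\<^sub>R stoch_grad xs t"
proof -
  have "virtual \<gamma> xs (Suc t)
      = iterate xs t - (\<eta> + \<gamma> * \<mu>) *\<^sub>R momentum xs (Suc t)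
        - \<gamma> *\<^sub>R avg_error xs (Suc t)"
    by (simp add: virtual_def state_Suc(3) algebra_simps)
  also have "\<eta> + \<gamma> * \<mu> = \<gamma>"
    using assms by (simp add: algebra_simps)
  also have "iterate xs t - \<gamma> *\<^sub>R momentum xs (Suc t) - \<gamma> *\<^sub>R avg_error xs (Suc t)
      = iterate xs t - \<gamma> *\<^sub>R (momentum xs (Suc t) + avg_error xs (Suc t))"
    by (simp add: scaleR_add_right)
  also have "momentum xs (Suc t) + avg_error xs (Suc t) = \<mu> *\<^sub>R momentum xs t
    + stoch_grad xs t + avg_error xs t"
    by (simp add: momentum_Suc_avg avg_error_Suc)
  finally show ?thesis
    by (simp add: virtual_def algebra_simps)
qed

lemma iterate_minus_virtual:
  "iterate xs t - virtual \<gamma> xs t = \<gamma> *\<^sub>R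
    (\<mu> *\<^sub>R momentum xs t + avg_error xs t)"
  by (simp add: virtual_def scaleR_add_right)

lemma rank_le_rows: "CARD('r::{finite,wellorder}) \<le> CARD('m::{finite,wellorder})"
  using rank by linarith

lemma basis_orthonormal: "transpose (basis xs t) ** basis xs t = mat 1"
proof (cases "t mod \<tau> = 0")
  case True
  then show ?thesis
    using is_top_left_sv_orthonormal[OF svd rank_le_rows] by (simp add: basis_def)
next
  case False
  then show ?thesis
    using qr by (simp add: basis_def is_econ_QR_def)
qed

lemma norm_projector_le: "norm (projector xs t ** D) \<le> norm D"
  and norm_projector_residual_le: "norm (D - projector xs t ** D) \<le> norm D"
proof -
  note Pythagoras = norm_projector_Pythagoras[OF basis_orthonormal, of xs t D, folded projector_def]
  have "(norm (projector xs t ** D))\<^sup>2 \<le> (norm D)\<^sup>2"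
    using Pythagoras zero_le_power2[of "norm (D - projector xs t ** D)"] by linarith
  then show "norm (projector xs t ** D) \<le> norm D"
    by (rule power2_le_imp_le) simp
  have "(norm (D - projector xs t ** D))\<^sup>2 \<le> (norm D)\<^sup>2"
    using Pythagoras zero_le_power2[of "norm (projector xs t ** D)"] by linarith
  then show "norm (D - projector xs t ** D) \<le> norm D"
    by (rule power2_le_imp_le) simp
qed

definition restart_factor where "restart_factor q t = (if t mod \<tau> = 0 then q else 1)"

lemma norm_avg_error_Suc_le:
  "norm (avg_error xs (Suc t))
    \<le> restart_factor (sqrt (1 - real CARD('r::{finite,wellorder})
      / real CARD('n::{finite,wellorder}))) t
      * norm (stoch_grad xs t + avg_error xs t)"
proof (cases "t mod \<tau> = 0")
  case True
  let ?D = "stoch_grad xs t + avg_error xs t"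
  have "basis xs t = svd ?D"
    using True by (simp add: basis_def avg_corrected)
  then have "(norm (avg_error xs (Suc t)))\<^sup>2
    = (norm (?D - svd ?D ** transpose (svd ?D) ** ?D))\<^sup>2"
    by (simp add: avg_error_Suc projector_def)
  also have "\<dots> \<le> (1 - real CARD('r::{finite,wellorder}) / real CARD('n::{finite,wellorder}))
    * (norm ?D)\<^sup>2"
    by (rule is_top_left_sv_residual[OF svd rank])
  also have "\<dots> = (sqrt (1 - real CARD('r::{finite,wellorder}) / real CARD('n::{finite,wellorder}))
    * norm ?D)\<^sup>2"
    using rank by (simp add: power_mult_distrib)
  finally have "norm (avg_error xs (Suc t))
      \<le> sqrt (1 - real CARD('r::{finite,wellorder}) / real CARD('n::{finite,wellorder})) * norm ?D"
    by (rule power2_le_imp_le) (use rank in simp)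
  then show ?thesis
    using True by (simp add: restart_factor_def)
next
  case False
  then show ?thesis
    using norm_projector_residual_le[where D="stoch_grad xs t + avg_error xs t"]
    by (simp add: restart_factor_def avg_error_Suc)
qed

primrec error_weight :: "real \<Rightarrow> nat \<Rightarrow> nat \<Rightarrow> real" where
  "error_weight q 0 s = 0"
| "error_weight q (Suc t) s = restart_factor q t * (error_weight q t s + (if s = t then 1 else 0))"

primrec momentum_weight :: "real \<Rightarrow> nat \<Rightarrow> nat \<Rightarrow> real" where
  "momentum_weight q 0 s = 0"
| "momentum_weight q (Suc t) s = \<mu> * momentum_weight q t s + (if s = t then 1 else 0)
  + error_weight q t s"

lemma error_weight_eq_0: "t \<le> s \<Longrightarrow> error_weight q t s = 0"
  by (induction t) auto

lemma momentum_weight_eq_0: "t \<le> s \<Longrightarrow> momentum_weight q t s = 0"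
  by (induction t) (auto simp: error_weight_eq_0)

lemma error_weight_nonneg: "0 \<le> q \<Longrightarrow> 0 \<le> error_weight q t s"
  by (induction t) (auto simp: restart_factor_def)

lemma momentum_weight_nonneg: "0 \<le> q \<Longrightarrow> 0 \<le> momentum_weight q t s"
  using momentum_factor by (induction t) (auto simp: error_weight_nonneg)

lemma sum_error_weight_Suc:
  "(\<Sum>s<Suc t. error_weight q (Suc t) s * a s) = restart_factor q t
    * ((\<Sum>s<t. error_weight q t s * a s) + a t)"
  by (simp add: sum_distrib_left error_weight_eq_0 algebra_simps)

lemma sum_momentum_weight_Suc:
  "(\<Sum>s<Suc t. momentum_weight q (Suc t) s * a s)
    = \<mu> * (\<Sum>s<t. momentum_weight q t s * a s) + a t + (\<Sum>s<t. error_weight q t s * a s)"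
  by (simp add: sum.distrib sum_distrib_left error_weight_eq_0 momentum_weight_eq_0 algebra_simps)

lemma norm_avg_error_le:
  assumes q: "q = sqrt (1 - real CARD('r::{finite,wellorder}) / real CARD('n::{finite,wellorder}))"
  shows "norm (avg_error xs t) \<le> (\<Sum>s<t. error_weight q t s * norm (stoch_grad xs s))"
proof (induction t)
  case 0
  then show ?case
    by (simp add: avg_error_def state_0)
next
  case (Suc t)
  have "0 \<le> restart_factor q t"
    using rank by (simp add: q restart_factor_def)
  have "norm (avg_error xs (Suc t)) \<le> restart_factor q t * norm (stoch_grad xs t + avg_error xs t)"
    using norm_avg_error_Suc_le q by simp
  also have "\<dots> \<le> restart_factor q t
    * (norm (stoch_grad xs t) + (\<Sum>s<t. error_weight q t s * norm (stoch_grad xs s)))"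
    using Suc.IH norm_triangle_ineq[of "stoch_grad xs t" "avg_error xs t"] \<open>0
      \<le> restart_factor q t\<close>
    by (intro mult_left_mono) auto
  also have "\<dots> = (\<Sum>s<Suc t. error_weight q (Suc t) s * norm (stoch_grad xs s))"
    unfolding sum_error_weight_Suc by (simp add: algebra_simps)
  finally show ?case .
qed

lemma norm_momentum_le:
  assumes q: "q = sqrt (1 - real CARD('r::{finite,wellorder}) / real CARD('n::{finite,wellorder}))"
  shows "norm (momentum xs t) \<le> (\<Sum>s<t. momentum_weight q t s * norm (stoch_grad xs s))"
proof (induction t)
  case 0
  then show ?case
    by (simp add: state_0)
next
  case (Suc t)
  have "norm (momentum xs (Suc t)) \<le> \<mu> * norm (momentum xs t)
    + norm (stoch_grad xs t + avg_error xs t)"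
    unfolding momentum_Suc_avg
    using norm_triangle_ineq[of "\<mu> *\<^sub>R momentum xs t" "projector xs t
      ** (stoch_grad xs t + avg_error xs t)"]
      norm_projector_le[of xs t "stoch_grad xs t + avg_error xs t"] momentum_factor
    by simp
  also have "\<dots> \<le> \<mu> * (\<Sum>s<t. momentum_weight q t s * norm (stoch_grad xs s))
      + (norm (stoch_grad xs t) + (\<Sum>s<t. error_weight q t s * norm (stoch_grad xs s)))"
    using Suc.IH norm_avg_error_le[OF q] momentum_factor norm_triangle_ineq[of "stoch_grad xs t"
      "avg_error xs t"]
    by (intro add_mono mult_left_mono) (auto intro: order_trans)
  also have "\<dots> = (\<Sum>s<Suc t. momentum_weight q (Suc t) s * norm (stoch_grad xs s))"
    unfolding sum_momentum_weight_Suc by (simp add: algebra_simps)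
  finally show ?case .
qed

text \<open>Between two restarts the sum of error weights grows by one per step, and a restart
  multiplies it by \<open>q\<close>. The invariant bounds it
    by the fixed point \<open>S\<close> of one period, minus the number
  of steps left before the next restart.\<close>

lemma sum_error_weight_le:
  assumes q: "0 \<le> q" "q < 1"
  shows "(\<Sum>s<t. error_weight q t s) \<le> real \<tau> / (1 - q)"
proof -
  define S where "S = (q + real \<tau> - 1) / (1 - q)"
  have S_fixed: "q * (S + 1) + (real \<tau> - 1) = S"
    using q unfolding S_def by (simp add: field_simps)
  have invariant: "(\<Sum>s<t. error_weight q t s) \<le> S
    - (if t mod \<tau> = 0 then 0 else real \<tau> - real (t mod \<tau>))" for t
  proof (induction t)
    case 0
    show ?case
      using q period by (simp add: S_def)
  next
    case (Suc t)
    have step: "(\<Sum>s<Suc t. error_weight q (Suc t) s) = restart_factor q t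
      * ((\<Sum>s<t. error_weight q t s) + 1)"
      using sum_error_weight_Suc[of q t "\<lambda>_. 1"] by simp
    show ?case
    proof (cases "t mod \<tau> = 0")
      case True
      then have "(\<Sum>s<Suc t. error_weight q (Suc t) s) \<le> q * (S + 1)"
        using Suc.IH q step by (simp add: restart_factor_def mult_left_mono)
      also have "\<dots> = S - (real \<tau> - 1)"
        using S_fixed by simp
      finally show ?thesis
        using True period by (cases "\<tau> = 1") (simp_all add: mod_Suc)
    next
      case False
      then have "(\<Sum>s<Suc t. error_weight q (Suc t) s) \<le> S - (real \<tau> - real (t mod \<tau>))
        + 1"
        using Suc.IH step by (simp add: restart_factor_def)
      then show ?thesis
        using False by (cases "Suc (t mod \<tau>) = \<tau>") (simp_all add: mod_Suc)
    qed
  qed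
  have "t mod \<tau> < \<tau>"
    using period by simp
  then have "(\<Sum>s<t. error_weight q t s) \<le> S"
    using invariant[of t] by (auto split: if_splits)
  also have "S \<le> real \<tau> / (1 - q)"
    unfolding S_def using q by (simp add: divide_right_mono)
  finally show ?thesis .
qed

lemma sum_momentum_weight_le:
  assumes q: "0 \<le> q" "q < 1"
  shows "(\<Sum>s<t. momentum_weight q t s) \<le> (1 + real \<tau> / (1 - q)) / (1 - \<mu>)"
proof -
  define K where "K = real \<tau> / (1 - q)"
  have "(\<Sum>s<t. momentum_weight q t s) \<le> (1 + K) / (1 - \<mu>)"
  proof (induction t)
    case 0
    then show ?case
      using q momentum_factor by (simp add: K_def)
  next
    case (Suc t)
    have "(\<Sum>s<Suc t. momentum_weight q (Suc t) s)
        = \<mu> * (\<Sum>s<t. momentum_weight q t s) + 1 + (\<Sum>s<t. error_weight q t s)"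
      using sum_momentum_weight_Suc[of q t "\<lambda>_. 1"] by simp
    also have "\<dots> \<le> \<mu> * ((1 + K) / (1 - \<mu>)) + 1 + K"
      using Suc.IH sum_error_weight_le[OF q] momentum_factor unfolding K_def
      by (intro add_mono mult_left_mono) auto
    also have "\<dots> = (1 + K) / (1 - \<mu>)"
      using momentum_factor by (simp add: field_simps)
    finally show ?case .
  qed
  then show ?thesis
    by (simp add: K_def)
qed

definition lag_weight where "lag_weight q t s = \<mu> * momentum_weight q t s + error_weight q t s"

lemma lag_weight_nonneg: "0 \<le> q \<Longrightarrow> 0 \<le> lag_weight q t s"
  using momentum_factor by (simp add: lag_weight_def momentum_weight_nonneg error_weight_nonneg)

lemma sum_lag_weight_le:
  assumes q: "0 \<le> q" "q < 1"
  shows "(\<Sum>s<t. lag_weight q t s) \<le> (1 + real \<tau> / (1 - q)) / (1 - \<mu>)"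
proof -
  define K where "K = real \<tau> / (1 - q)"
  have "(\<Sum>s<t. lag_weight q t s) = \<mu> * (\<Sum>s<t. momentum_weight q t s)
    + (\<Sum>s<t. error_weight q t s)"
    by (simp add: lag_weight_def sum.distrib sum_distrib_left)
  also have "\<dots> \<le> \<mu> * ((1 + K) / (1 - \<mu>)) + K"
    using sum_momentum_weight_le[OF q] sum_error_weight_le[OF q] momentum_factor unfolding K_def
    by (intro add_mono mult_left_mono) auto
  also have "\<dots> = (1 + K) / (1 - \<mu>) - 1"
    using momentum_factor by (simp add: field_simps)
  finally show ?thesis
    by (simp add: K_def)
qed

lemma norm_iterate_minus_virtual_le:
  assumes q: "q = sqrt (1 - real CARD('r::{finite,wellorder}) / real CARD('n::{finite,wellorder}))"
    and W: "(\<Sum>s<t. lag_weight q t s) \<le> W"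
  shows "(norm (iterate xs t - virtual \<gamma> xs t))\<^sup>2
    \<le> \<gamma>\<^sup>2 * W * (\<Sum>s<t. lag_weight q t s * (norm (stoch_grad xs s))\<^sup>2)"
proof -
  have q0: "0 \<le> q"
    using rank by (simp add: q)
  have "norm (\<mu> *\<^sub>R momentum xs t + avg_error xs t) \<le> \<mu> * norm (momentum xs t)
    + norm (avg_error xs t)"
    using norm_triangle_ineq[of "\<mu> *\<^sub>R momentum xs t" "avg_error xs t"] momentum_factor by simp
  also have "\<dots> \<le> \<mu> * (\<Sum>s<t. momentum_weight q t s * norm (stoch_grad xs s))
      + (\<Sum>s<t. error_weight q t s * norm (stoch_grad xs s))"
    using norm_momentum_le[OF q] norm_avg_error_le[OF q] momentum_factor by (intro add_mono mult_left_mono)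
  also have "\<dots> = (\<Sum>s<t. lag_weight q t s * norm (stoch_grad xs s))"
    by (simp add: lag_weight_def sum.distrib sum_distrib_left algebra_simps)
  finally have "(norm (iterate xs t - virtual \<gamma> xs t))\<^sup>2
      \<le> \<gamma>\<^sup>2 * (\<Sum>s<t. lag_weight q t s * norm (stoch_grad xs s))\<^sup>2"
    unfolding iterate_minus_virtual by (simp add: power_mult_distrib power_mono mult_left_mono)
  also have "\<dots> \<le> \<gamma>\<^sup>2 *
    ((\<Sum>s<t. lag_weight q t s) * (\<Sum>s<t. lag_weight q t s * (norm (stoch_grad xs s))\<^sup>2))"
    using power2_weighted_sum_le[of "{..<t}" "lag_weight q t"] lag_weight_nonneg[OF q0]
    by (intro mult_left_mono) auto
  also have "\<dots> \<le> \<gamma>\<^sup>2 *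
    (W * (\<Sum>s<t. lag_weight q t s * (norm (stoch_grad xs s))\<^sup>2))"
    using W lag_weight_nonneg[OF q0] by (intro mult_left_mono mult_right_mono sum_nonneg) auto
  finally show ?thesis
    by (simp add: mult.assoc)
qed

end

lemma Lipschitz_gradient_upper_bound:
  fixes f :: "'a::real_inner \<Rightarrow> real" and g :: "'a \<Rightarrow> 'a"
  assumes deriv: "\<And>X. (f has_derivative (\<lambda>H. g X \<bullet> H)) (at X)"
    and Lipschitz: "\<And>X Y. norm (g X - g Y) \<le> L * norm (X - Y)"
  shows "f Y \<le> f X + g X \<bullet> (Y - X) + L / 2 * (norm (Y - X))\<^sup>2"
proof -
  define d where "d = Y - X"
  define \<psi> where "\<psi> s = f (X + s *\<^sub>R d) - s * (g X \<bullet> d) - L / 2 * s\<^sup>2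
    * (norm d)\<^sup>2" for s
  have deriv_\<psi>: "(\<psi> has_real_derivative
    (g (X + s *\<^sub>R d) \<bullet> d - g X \<bullet> d - L * s * (norm d)\<^sup>2)) (at s)" for s
  proof -
    have "((\<lambda>s. X + s *\<^sub>R d) has_derivative (\<lambda>h. h *\<^sub>R d)) (at s)"
      by (auto intro!: derivative_eq_intros)
    from has_derivative_compose[OF this deriv]
    have "((\<lambda>s. f (X + s *\<^sub>R d)) has_derivative
      (\<lambda>h. g (X + s *\<^sub>R d) \<bullet> (h *\<^sub>R d))) (at s)" .
    moreover have "(\<lambda>h. g (X + s *\<^sub>R d) \<bullet> (h *\<^sub>R d))
      = (*) (g (X + s *\<^sub>R d) \<bullet> d)"
      by (auto simp: fun_eq_iff)
    ultimately have "((\<lambda>s. f (X + s *\<^sub>R d)) has_real_derivative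
      (g (X + s *\<^sub>R d) \<bullet> d)) (at s)"
      by (simp add: has_field_derivative_def)
    then show ?thesis
      unfolding \<psi>_def by (auto intro!: derivative_eq_intros simp: power2_eq_square algebra_simps)
  qed
  have nonpos: "g (X + s *\<^sub>R d) \<bullet> d - g X \<bullet> d - L * s * (norm d)\<^sup>2
    \<le> 0" if "0 \<le> s" for s
  proof -
    have "g (X + s *\<^sub>R d) \<bullet> d - g X \<bullet> d \<le> norm (g (X + s *\<^sub>R d) - g X)
      * norm d"
      by (metis inner_diff_left norm_cauchy_schwarz)
    also have "\<dots> \<le> L * norm (s *\<^sub>R d) * norm d"
      using Lipschitz[of "X + s *\<^sub>R d" X] by (intro mult_right_mono) auto
    finally show ?thesis
      using that by (simp add: power2_eq_square mult.assoc)
  qed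
  have "\<psi> 1 \<le> \<psi> 0"
    using deriv_\<psi> nonpos by (intro DERIV_nonpos_imp_nonincreasing[of 0 1])
      (auto simp del: diff_le_0_iff_le)
  then show ?thesis
    unfolding \<psi>_def d_def by (simp add: algebra_simps)
qed

lemma gradient_of_average:
  fixes f :: "'a::real_inner \<Rightarrow> real"
  assumes "(f has_derivative (\<lambda>H. g \<bullet> H)) (at X)"
    and "\<And>X. f X = (\<Sum>i<N. fi i X) / real N"
    and "\<And>i. i < N \<Longrightarrow> (fi i has_derivative (\<lambda>H. gi i \<bullet> H)) (at X)"
  shows "g = (1 / real N) *\<^sub>R (\<Sum>i<N. gi i)"
proof -
  have "((\<lambda>X. (\<Sum>i<N. fi i X) * (1 / real N)) has_derivative
    (\<lambda>H. (\<Sum>i<N. gi i \<bullet> H) * (1 / real N))) (at X)"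
    using assms(3) by (intro has_derivative_mult_left has_derivative_sum) auto
  moreover have "f = (\<lambda>X. (\<Sum>i<N. fi i X) * (1 / real N))"
    using assms(2) by auto
  ultimately have "(f has_derivative (\<lambda>H. ((1 / real N) *\<^sub>R (\<Sum>i<N. gi i))
    \<bullet> H)) (at X)"
    by (simp add: inner_sum_left)
  from has_derivative_unique[OF assms(1) this]
  have "(g - (1 / real N) *\<^sub>R (\<Sum>i<N. gi i))
    \<bullet> (g - (1 / real N) *\<^sub>R (\<Sum>i<N. gi i)) = 0"
    by (metis inner_diff_left diff_self)
  then show ?thesis
    by simp
qed

lemma const_gradient_bounded_below_eq_0:
  fixes f :: "'a::real_inner \<Rightarrow> real"
  assumes deriv: "\<And>X. (f has_derivative (\<lambda>H. g X \<bullet> H)) (at X)"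
    and const: "\<And>X Y. g X = g Y" and "bdd_below (range f)"
  shows "g X = 0"
proof (rule ccontr)
  assume "g X \<noteq> 0"
  obtain B where B: "\<And>Y. B \<le> f Y"
    using \<open>bdd_below (range f)\<close> by (auto simp: bdd_below_def)
  define s where "s = (f X - B + 1) / (norm (g X))\<^sup>2"
  have "f (X - s *\<^sub>R g X) \<le> f X + g X \<bullet> ((X - s *\<^sub>R g X) - X) + 0 / 2
    * (norm ((X - s *\<^sub>R g X) - X))\<^sup>2"
    using const by (intro Lipschitz_gradient_upper_bound[OF deriv]) simp
  also have "\<dots> = B - 1"
    using \<open>g X \<noteq> 0\<close> by (simp add: s_def power2_norm_eq_inner)
  finally show False
    using B[of "X - s *\<^sub>R g X"] by simp
qed

lemma Lipschitz_constant_nonneg: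
  fixes g :: "'a::euclidean_space \<Rightarrow> 'b::real_normed_vector"
  assumes "\<And>X Y. norm (g X - g Y) \<le> L * norm (X - Y)"
  shows "0 \<le> L"
proof -
  obtain b :: 'a where "b \<in> Basis"
    using nonempty_Basis by blast
  then have "norm (g b - g 0) \<le> L"
    using assms[of b 0] by simp
  then show ?thesis
    using norm_ge_zero order_trans by blast
qed

lemma Lipschitz_borel_measurable:
  fixes g :: "'a::euclidean_space \<Rightarrow> 'b::real_normed_vector"
  assumes "\<And>X Y. norm (g X - g Y) \<le> L * norm (X - Y)"
  shows "g \<in> borel_measurable borel"
proof -
  have "continuous_on UNIV g"
    using assms Lipschitz_constant_nonneg[OF assms]
    by (intro lipschitz_on_continuous_on[of L] lipschitz_onI) (auto simp: dist_norm)
  then show ?thesis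
    by (rule borel_measurable_continuous_onI)
qed

text \<open>One step of SGD on the virtual sequence, with \<open>a\<close> the gradient at the iterate, \<open>u\<close> the gradient
  noise, \<open>b\<close> the gradient at the virtual point
    and \<open>d\<close> a bound on their distance.\<close>

lemma descent_step_bound:
  fixes a b u :: "'a::real_inner"
  assumes descent: "f' \<le> f + b \<bullet> (- (\<gamma> *\<^sub>R (a + u))) + L / 2
    * (norm (\<gamma> *\<^sub>R (a + u)))\<^sup>2"
    and Lipschitz: "norm (b - a) \<le> L * d" and "0 \<le> \<gamma>" "L * \<gamma> \<le> 1 / 2"
  shows "\<gamma> / 4 * (norm a)\<^sup>2
    \<le> f - f' + \<gamma> * L\<^sup>2 / 2 * d\<^sup>2 + L * \<gamma>\<^sup>2 / 2 * (norm u)\<^sup>2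
      - \<gamma> * ((b - (L * \<gamma>) *\<^sub>R a) \<bullet> u)"
proof -
  have "- (norm (b - a) * norm a) \<le> (b - a) \<bullet> a"
    using Cauchy_Schwarz_ineq2[of "b - a" a] by linarith
  moreover have "norm (b - a) * norm a \<le> ((L * d)\<^sup>2 + (norm a)\<^sup>2) / 2"
    using mult_right_mono[OF Lipschitz norm_ge_zero[of a]] sum_squares_bound[of "L * d" "norm a"]
    by (simp add: power2_eq_square)
  ultimately have "(norm a)\<^sup>2 / 2 - L\<^sup>2 * d\<^sup>2 / 2 \<le> b \<bullet> a"
    by (simp add: inner_diff_left power2_norm_eq_inner field_simps)
  then have "\<gamma> * ((norm a)\<^sup>2 / 2 - L\<^sup>2 * d\<^sup>2 / 2) \<le> \<gamma> * (b \<bullet> a)"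
    using \<open>0 \<le> \<gamma>\<close> by (rule mult_left_mono)
  moreover have "L * \<gamma>\<^sup>2 / 2 * (norm a)\<^sup>2 \<le> \<gamma> / 4 * (norm a)\<^sup>2"
    using mult_right_mono[OF \<open>L * \<gamma> \<le> 1 / 2\<close>, of "\<gamma>
      * (norm a)\<^sup>2"] \<open>0 \<le> \<gamma>\<close>
    by (simp add: power2_eq_square mult_ac)
  moreover have "(norm (\<gamma> *\<^sub>R (a + u)))\<^sup>2 = \<gamma>\<^sup>2
    * ((norm a)\<^sup>2 + 2 * (a \<bullet> u) + (norm u)\<^sup>2)"
    by (simp add: power_mult_distrib power2_norm_eq_inner inner_add_left inner_add_right inner_commute)
  ultimately show ?thesis
    using descent by (simp add: algebra_simps power2_eq_square)
qed

lemma abs_inner_le_sum_power2: "\<bar>x \<bullet> y\<bar> \<le> (norm x)\<^sup>2 + (norm y)\<^sup>2"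
proof -
  have "0 \<le> norm x * norm y"
    by simp
  then show ?thesis
    using Cauchy_Schwarz_ineq2[of x y] sum_squares_bound[of "norm x" "norm y"] by linarith
qed

lemma nn_integral_power2_norm_leD:
  fixes g :: "'a \<Rightarrow> 'b::{banach,second_countable_topology}"
  assumes "g \<in> borel_measurable M" "(\<integral>\<^sup>+x. ennreal ((norm (g x))\<^sup>2)
    \<partial>M) \<le> ennreal c" "0 \<le> c"
  shows "integrable M (\<lambda>x. (norm (g x))\<^sup>2)"
    and "(\<integral>x. (norm (g x))\<^sup>2 \<partial>M) \<le> c"
proof -
  have m: "(\<lambda>x. (norm (g x))\<^sup>2) \<in> borel_measurable M"
    using assms(1) by measurable
  show "integrable M (\<lambda>x. (norm (g x))\<^sup>2)"
    using assms(2) by (intro integrableI_bounded[OF m]) (simp add: le_less_trans)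
  have "(\<integral>x. (norm (g x))\<^sup>2 \<partial>M)
    = enn2real (\<integral>\<^sup>+x. ennreal ((norm (g x))\<^sup>2) \<partial>M)"
    by (rule integral_eq_nn_integral[OF m]) simp
  also have "\<dots> \<le> c"
    using assms(2,3) by (simp add: enn2real_leI)
  finally show "(\<integral>x. (norm (g x))\<^sup>2 \<partial>M) \<le> c" .
qed

lemma (in prob_space) distr_restrict_pair_indep_vars:
  assumes indep: "indep_vars M' X I" and "A \<inter> B
    = {}" "A \<subseteq> I" "B \<subseteq> I" "A \<noteq> {}" "B \<noteq> {}"
    and distr: "\<And>p. p \<in> I \<Longrightarrow> distr M (M' p) (X p) = M' p"
  shows "distr M (PiM A M' \<Otimes>\<^sub>M PiM B M')
    (\<lambda>w. (\<lambda>p\<in>A. X p w, \<lambda>p\<in>B. X p w)) = PiM A M' \<Otimes>\<^sub>M PiM B M'"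
proof -
  have distr_restrict: "distr M (PiM C M') (\<lambda>w. \<lambda>p\<in>C. X p w)
    = PiM C M'" if C: "C \<subseteq> I" "C \<noteq> {}" for C
  proof -
    have "\<And>p. p \<in> C \<Longrightarrow> random_variable (M' p) (X p)"
      using indep C(1) unfolding indep_vars_def by blast
    with indep_vars_subset[OF indep C(1)]
    have "distr M (PiM C M') (\<lambda>w. \<lambda>p\<in>C. X p w)
      = PiM C (\<lambda>p. distr M (M' p) (X p))"
      using indep_vars_iff_distr_eq_PiM'[OF C(2)] by blast
    also have "\<dots> = PiM C M'"
      using distr C(1) by (intro PiM_cong) auto
    finally show ?thesis .
  qed
  have "indep_var (PiM A M') (\<lambda>w. \<lambda>p\<in>A. X p w) (PiM B M')
    (\<lambda>w. \<lambda>p\<in>B. X p w)"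
    using indep_var_restrict[OF indep assms(2-4)] .
  then show ?thesis
    unfolding indep_var_distribution_eq distr_restrict[OF assms(3,5)] distr_restrict[OF assms(4,6)]
    by (simp add: eq_commute)
qed

lemma indep_vars_PiM_components:
  assumes prob: "\<And>i. i \<in> I \<Longrightarrow> prob_space (D i)" and "I \<noteq> {}"
  shows "prob_space.indep_vars (PiM I D) D (\<lambda>k y. y k) I"
proof -
  interpret P: prob_space "PiM I D"
    using prob by (intro prob_space_PiM) auto
  have components: "\<And>k. k \<in> I \<Longrightarrow> distr (PiM I D) (D k) (\<lambda>y. y k) = D k"
    by (rule distr_PiM_component[OF prob]) auto
  have "distr (PiM I D) (PiM I D) (\<lambda>y. \<lambda>k\<in>I. y k)
    = distr (PiM I D) (PiM I D) (\<lambda>y. y)"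
    by (intro distr_cong) (auto simp: space_PiM PiE_def extensional_restrict)
  also have "\<dots> = PiM I D"
    by (rule distr_id2) simp
  also have "\<dots> = PiM I (\<lambda>k. distr (PiM I D) (D k) (\<lambda>y. y k))"
    using components by (intro PiM_cong) auto
  finally show ?thesis
    using iffD2[OF P.indep_vars_iff_distr_eq_PiM'[where M'=D and X="\<lambda>k y. y k", OF assms(2)]]
    by (simp add: measurable_component_singleton)
qed

lemma PiM_integral_inner_components_eq_0:
  fixes a :: "'i \<Rightarrow> 'b \<Rightarrow> 'v::euclidean_space"
  assumes prob: "\<And>k. k \<in> I \<Longrightarrow> prob_space (D k)" and ij: "i \<in> I" "j
    \<in> I" "i \<noteq> j"
    and meas: "a i \<in> borel_measurable (D i)" "a j \<in> borel_measurable (D j)"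
    and int: "integrable (PiM I D) (\<lambda>y. a i (y i) \<bullet> a j (y j))" "integrable (D j) (a j)"
    and mean: "integral\<^sup>L (D j) (a j) = 0"
  shows "(\<integral>y. a i (y i) \<bullet> a j (y j) \<partial>PiM I D) = 0"
proof -
  let ?A = "PiM {i} D" and ?B = "PiM {j} D"
  interpret P: prob_space "PiM I D"
    using prob by (intro prob_space_PiM) auto
  interpret A: prob_space ?A
    using prob ij by (intro prob_space_PiM) auto
  interpret B: prob_space ?B
    using prob ij by (intro prob_space_PiM) auto
  interpret AB: pair_prob_space ?A ?B ..
  define F where "F = (\<lambda>uv. a i (fst uv i) \<bullet> a j (snd uv j))"
  have F: "F \<in> borel_measurable (?A \<Otimes>\<^sub>M ?B)"
  proof -
    have "(\<lambda>uv. fst uv i) \<in> measurable (?A \<Otimes>\<^sub>M ?B) (D i)"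
      "(\<lambda>uv. snd uv j) \<in> measurable (?A \<Otimes>\<^sub>M ?B) (D j)"
      by (auto intro!: measurable_compose[OF measurable_fst] measurable_compose[OF measurable_snd]
          measurable_component_singleton)
    then show ?thesis
      unfolding F_def using meas by measurable
  qed
  have distr: "distr (PiM I D) (?A \<Otimes>\<^sub>M ?B)
    (\<lambda>y. (\<lambda>k\<in>{i}. y k, \<lambda>k\<in>{j}. y k)) = ?A \<Otimes>\<^sub>M ?B"
    using ij distr_PiM_component[OF prob]
    by (intro P.distr_restrict_pair_indep_vars[OF indep_vars_PiM_components[OF prob]]) auto
  have restrict: "(\<lambda>y. (\<lambda>k\<in>{i}. y k, \<lambda>k\<in>{j}. y k))
    \<in> measurable (PiM I D) (?A \<Otimes>\<^sub>M ?B)"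
    using ij by (intro measurable_Pair measurable_restrict_subset) auto
  have "(\<integral>y. a i (y i) \<bullet> a j (y j) \<partial>PiM I D)
    = integral\<^sup>L (?A \<Otimes>\<^sub>M ?B) F"
    using integral_distr[OF restrict F] distr by (simp add: F_def)
  moreover have "integrable (?A \<Otimes>\<^sub>M ?B) F"
    using integrable_distr_eq[OF restrict F] distr int(1) by (simp add: F_def)
  ultimately have "(\<integral>y. a i (y i) \<bullet> a j (y j) \<partial>PiM I D)
    = (\<integral>u. (\<integral>v. F (u, v) \<partial>?B) \<partial>?A)"
    by (simp add: AB.integral_fst')
  also have "\<dots> = 0"
  proof -
    have component: "(\<lambda>v. v j) \<in> measurable ?B (D j)" "distr ?B (D j) (\<lambda>v. v j) = D j"
      by (auto intro: measurable_component_singleton) (rule distr_PiM_component[OF prob], use ij in auto)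
    have "integrable ?B (\<lambda>v. a j (v j))" "(\<integral>v. a j (v j) \<partial>?B) = 0"
      using integrable_distr_eq[OF component(1) meas(2)] integral_distr[OF component(1) meas(2)]
        component(2) int(2) mean by simp_all
    then show ?thesis
      by (simp add: F_def)
  qed
  finally show ?thesis .
qed

text \<open>The variance of a sum of independent centred random vectors is the sum of their variances.\<close>

lemma PiM_nn_integral_norm_sum_le:
  fixes a :: "'i \<Rightarrow> 'b \<Rightarrow> 'v::euclidean_space"
  assumes "finite I" and prob: "\<And>i. i \<in> I \<Longrightarrow> prob_space (D i)"
    and meas: "\<And>i. i \<in> I \<Longrightarrow> a i \<in> borel_measurable (D i)"
    and int: "\<And>i. i \<in> I \<Longrightarrow> integrable (D i) (a i)"
    and mean: "\<And>i. i \<in> I \<Longrightarrow> integral\<^sup>L (D i) (a i) = 0"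
    and var: "\<And>i. i \<in> I \<Longrightarrow>
      (\<integral>\<^sup>+z. ennreal ((norm (a i z))\<^sup>2) \<partial>D i) \<le> ennreal s2" and "0
      \<le> s2"
  shows "(\<integral>\<^sup>+y. ennreal ((norm (\<Sum>i\<in>I. a i (y i)))\<^sup>2) \<partial>PiM I D)
    \<le> ennreal (real (card I) * s2)"
proof -
  let ?P = "PiM I D"
  interpret P: prob_space ?P
    using prob by (intro prob_space_PiM) auto
  have component: "(\<lambda>y. y i) \<in> measurable ?P (D i)" "distr ?P (D i) (\<lambda>y. y i)
    = D i" if "i \<in> I" for i
    using that distr_PiM_component[OF prob] by (auto intro: measurable_component_singleton)
  have meas_P: "(\<lambda>y. a i (y i)) \<in> borel_measurable ?P" if "i \<in> I" for i
    using measurable_compose[OF component(1)[OF that] meas[OF that]] .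
  have "integrable ?P (\<lambda>y. (norm (a i (y i)))\<^sup>2)
    \<and> (\<integral>y. (norm (a i (y i)))\<^sup>2 \<partial>?P) \<le> s2" if i: "i \<in> I" for i
  proof -
    have "(\<integral>\<^sup>+y. ennreal ((norm (a i (y i)))\<^sup>2) \<partial>?P)
        = (\<integral>\<^sup>+z. ennreal ((norm (a i z))\<^sup>2) \<partial>distr ?P (D i)
          (\<lambda>y. y i))"
      using meas[OF i] component[OF i] by (subst nn_integral_distr) auto
    also have "\<dots> \<le> ennreal s2"
      using var[OF i] component(2)[OF i] by simp
    finally have "(\<integral>\<^sup>+y. ennreal ((norm (a i (y i)))\<^sup>2) \<partial>?P)
      \<le> ennreal s2" .
    from nn_integral_power2_norm_leD[OF meas_P[OF i] this \<open>0 \<le> s2\<close>] show ?thesis ..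
  qed
  then have square: "\<And>i. i \<in> I \<Longrightarrow> integrable ?P
    (\<lambda>y. (norm (a i (y i)))\<^sup>2)"
    and square_le: "\<And>i. i \<in> I \<Longrightarrow>
      (\<integral>y. (norm (a i (y i)))\<^sup>2 \<partial>?P) \<le> s2"
    by blast+
  have cross: "integrable ?P (\<lambda>y. a i (y i) \<bullet> a j (y j))" if "i \<in> I" "j \<in> I" for i j
  proof (rule Bochner_Integration.integrable_bound)
    show "integrable ?P (\<lambda>y. (norm (a i (y i)))\<^sup>2 + (norm (a j (y j)))\<^sup>2)"
      using square that by simp
    show "(\<lambda>y. a i (y i) \<bullet> a j (y j)) \<in> borel_measurable ?P"
      using meas_P that by measurable
  qed (use abs_inner_le_sum_power2 in auto)
  have expand: "(norm (\<Sum>i\<in>I. a i (y i)))\<^sup>2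
    = (\<Sum>i\<in>I. \<Sum>j\<in>I. a i (y i) \<bullet> a j (y j))" for y
    unfolding power2_norm_eq_inner inner_sum_left inner_sum_right by (rule sum.swap)
  have "(\<integral>y. (norm (\<Sum>i\<in>I. a i (y i)))\<^sup>2 \<partial>?P)
    = (\<Sum>i\<in>I. \<Sum>j\<in>I. \<integral>y. a i (y i) \<bullet> a j (y j) \<partial>?P)"
    unfolding expand using cross by (simp add: Bochner_Integration.integral_sum)
  also have "\<dots> = (\<Sum>i\<in>I. \<integral>y. (norm (a i (y i)))\<^sup>2 \<partial>?P)"
  proof (rule sum.cong[OF refl])
    fix i assume i: "i \<in> I"
    have "(\<integral>y. a i (y i) \<bullet> a j (y j) \<partial>?P) = 0" if j: "j
      \<in> I" "j \<noteq> i" for j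
      using PiM_integral_inner_components_eq_0[OF prob i j(1) j(2)[symmetric] meas[OF i] meas[OF j(1)]
          cross[OF i j(1)] int[OF j(1)] mean[OF j(1)]] .
    then have "(\<Sum>j\<in>I. \<integral>y. a i (y i) \<bullet> a j (y j) \<partial>?P)
      = (\<Sum>j\<in>I. if j = i then \<integral>y. a i (y i) \<bullet> a i (y i) \<partial>?P else 0)"
      by (intro sum.cong) auto
    then show "(\<Sum>j\<in>I. \<integral>y. a i (y i) \<bullet> a j (y j) \<partial>?P)
      = (\<integral>y. (norm (a i (y i)))\<^sup>2 \<partial>?P)"
      using \<open>i \<in> I\<close> \<open>finite I\<close> by (simp add: power2_norm_eq_inner)
  qed
  also have "\<dots> \<le> real (card I) * s2"
    using sum_mono[of I _ "\<lambda>_. s2", OF square_le] by simp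
  finally have "(\<integral>y. (norm (\<Sum>i\<in>I. a i (y i)))\<^sup>2 \<partial>?P)
    \<le> real (card I) * s2" .
  moreover have "integrable ?P (\<lambda>y. (norm (\<Sum>i\<in>I. a i (y i)))\<^sup>2)"
    unfolding expand using cross by simp
  ultimately show ?thesis
    by (simp add: nn_integral_eq_integral ennreal_leI)
qed

locale powersgd_sampling = powersgd qr svd \<tau> \<eta> \<mu> N gF X0 Q0
  for qr :: "real^('r::{finite,wellorder})^('m::{finite,wellorder})
      \<Rightarrow> real^('r::{finite,wellorder})^('m::{finite,wellorder})"
    and svd :: "real^('n::{finite,wellorder})^('m::{finite,wellorder})
      \<Rightarrow> real^('r::{finite,wellorder})^('m::{finite,wellorder})"
    and \<tau> :: nat and \<eta> \<mu> :: real and N :: nat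
    and gF :: "real^('n::{finite,wellorder})^('m::{finite,wellorder}) \<Rightarrow> 'b
      \<Rightarrow> real^('n::{finite,wellorder})^('m::{finite,wellorder})"
    and X0 :: "real^('n::{finite,wellorder})^('m::{finite,wellorder})"
    and Q0 :: "real^('r::{finite,wellorder})^('n::{finite,wellorder})" +
  fixes M :: "'a measure" and \<xi> :: "nat \<Rightarrow> nat \<Rightarrow> 'a \<Rightarrow> 'b"
    and D :: "nat \<Rightarrow> 'b measure"
    and grad_fi :: "nat \<Rightarrow> real^('n::{finite,wellorder})^('m::{finite,wellorder})
      \<Rightarrow> real^('n::{finite,wellorder})^('m::{finite,wellorder})"
    and grad_f :: "real^('n::{finite,wellorder})^('m::{finite,wellorder})
      \<Rightarrow> real^('n::{finite,wellorder})^('m::{finite,wellorder})"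
    and \<sigma>2 G2 :: real
  assumes prob_M: "prob_space M"
    and nodes: "1 \<le> N"
    and sample_measurable: "\<And>t i. i < N \<Longrightarrow> \<xi> t i \<in> measurable M (D i)"
    and sample_distr: "\<And>t i. i < N \<Longrightarrow> distr M (D i) (\<xi> t i) = D i"
    and sample_indep: "prob_space.indep_vars M (\<lambda>(t, i). D i) (\<lambda>(t, i). \<xi> t i)
      (UNIV \<times> {..<N})"
    and prob_D: "\<And>i. i < N \<Longrightarrow> prob_space (D i)"
    and gF_measurable: "\<And>i. i < N \<Longrightarrow> (\<lambda>(X, z). gF X z)
      \<in> borel_measurable (borel \<Otimes>\<^sub>M D i)"
    and qr_measurable: "qr \<in> borel_measurable borel" and svd_measurable: "svd
      \<in> borel_measurable borel"
    and unbiased: "\<And>i X. i < N \<Longrightarrow> integrable (D i) (gF X)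
      \<and> (\<integral>z. gF X z \<partial>D i) = grad_fi i X"
    and variance: "\<And>i X. i < N \<Longrightarrow>
      (\<integral>\<^sup>+z. ennreal ((norm (gF X z - grad_fi i X))\<^sup>2) \<partial>D i)
      \<le> ennreal \<sigma>2"
    and variance_nonneg: "0 \<le> \<sigma>2"
    and second_moment: "\<And>X. (\<integral>\<^sup>+z. ennreal
      ((norm ((1 / real N) *\<^sub>R (\<Sum>i<N. gF X (z i))))\<^sup>2) \<partial>PiM {..<N} D)
      \<le> ennreal G2"
    and second_moment_nonneg: "0 \<le> G2"
    and grad_avg: "\<And>X. grad_f X = (1 / real N) *\<^sub>R (\<Sum>i<N. grad_fi i X)"
    and grad_measurable: "grad_f \<in> borel_measurable borel"
begin

interpretation P: prob_space M by (rule prob_M)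

definition sample_path where "sample_path w = (\<lambda>s i. \<xi> s i w)"
definition history_path :: "(nat \<times> nat \<Rightarrow> 'b) \<Rightarrow> nat \<Rightarrow> nat
  \<Rightarrow> 'b" where "history_path x = (\<lambda>s i. x (s, i))"
definition past where "past t = {..<t} \<times> {..<N} \<union> {(Suc t, 0)}"
definition present where "present t = {t} \<times> {..<N}"
definition coord_space :: "nat \<times> nat \<Rightarrow> 'b measure" where "coord_space
  = (\<lambda>(s, i). D i)"
definition coord :: "nat \<times> nat \<Rightarrow> 'a \<Rightarrow> 'b" where "coord
  = (\<lambda>(s, i). \<xi> s i)"
definition history where "history t w = restrict (\<lambda>p. coord p w) (past t)"
definition current where "current t w = restrict (\<lambda>p. coord p w) (present t)"
definition past_space where "past_space t = PiM (past t) coord_space"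
definition present_space where "present_space t = PiM (present t) coord_space"
definition nodes_space where "nodes_space = PiM {..<N} D"
definition node_samples where "node_samples t y = (\<lambda>i\<in>{..<N}. y (t, i))"

lemma distr_history_current: "distr M (past_space t \<Otimes>\<^sub>M present_space t)
  (\<lambda>w. (history t w, current t w)) = past_space t \<Otimes>\<^sub>M present_space t"
  unfolding past_space_def present_space_def history_def current_def
proof (rule P.distr_restrict_pair_indep_vars)
  show "P.indep_vars coord_space coord (UNIV \<times> {..<N})" using sample_indep
    unfolding coord_space_def coord_def .
  show "past t \<inter> present t = {}" unfolding past_def present_def by auto
  show "past t \<subseteq> UNIV \<times> {..<N}" unfolding past_def using nodes by auto
  show "present t \<subseteq> UNIV \<times> {..<N}" unfolding present_def by auto
  show "past t \<noteq> {}" unfolding past_def by auto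
  have "(t, 0) \<in> present t" using nodes by (simp add: present_def)
  then show "present t \<noteq> {}" by blast
  show "distr M (coord_space p) (coord p) = coord_space p" if "p \<in> UNIV \<times> {..<N}" for p
    using that sample_distr unfolding coord_space_def coord_def by (cases p) auto
qed

lemma prob_space_coord_space: "p \<in> UNIV \<times> {..<N} \<Longrightarrow> prob_space (coord_space p)"
  unfolding coord_space_def using prob_D by (cases p) auto

lemma node_samples_measurable: "node_samples t \<in> measurable (present_space t) nodes_space"
  unfolding node_samples_def present_space_def nodes_space_def
proof (rule measurable_restrict)
  fix i assume "i \<in> {..<N}"
  then have "(\<lambda>y. y (t, i)) \<in> measurable (PiM (present t) coord_space) (coord_space (t, i))"
    by (intro measurable_component_singleton) (auto simp: present_def)
  then show "(\<lambda>y. y (t, i)) \<in> measurable (PiM (present t) coord_space) (D i)"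
    by (simp add: coord_space_def)
qed

lemma distr_node_samples: "distr (present_space t) nodes_space (node_samples t) = nodes_space"
proof -
  have "distr (PiM (present t) coord_space) (PiM {..<N} (\<lambda>i. coord_space (t, i)))
    (\<lambda>\<omega>. \<lambda>n\<in>{..<N}. \<omega> (t, n))
    = PiM {..<N} (\<lambda>i. coord_space (t, i))"
    by (rule distr_PiM_reindex) (auto simp: present_def inj_on_def intro: prob_space_coord_space)
  moreover have "PiM {..<N} (\<lambda>i. coord_space (t, i)) = nodes_space"
    unfolding nodes_space_def coord_space_def by simp
  ultimately show ?thesis unfolding present_space_def node_samples_def by simp
qed

lemma history_measurable: "history t \<in> measurable M (past_space t)"
  unfolding history_def past_space_def
  using nodes by (intro measurable_restrict) (auto simp: past_def coord_space_def coord_def intro!: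
    sample_measurable)

lemma current_measurable: "current t \<in> measurable M (present_space t)"
  unfolding current_def present_space_def
  by (intro measurable_restrict) (auto simp: present_def coord_space_def coord_def sample_measurable)

lemma state_path_eq_history_path:
  "iterate (sample_path w) t = iterate (history_path (history t w)) t \<and> prev_Q (sample_path w) t
    = prev_Q (history_path (history t w)) t \<and> momentum (sample_path w) t
    = momentum (history_path (history t w)) t
    \<and> (\<forall>i<N. error (sample_path w) t i = error (history_path (history t w)) t i)"
  by (rule state_eq_if_same_history) (simp add: sample_path_def history_path_def history_def past_def
    coord_def)

lemma avg_error_path_eq_history_path: "avg_error (sample_path w) t
  = avg_error (history_path (history t w)) t"
proof -
  have "(\<Sum>i<N. error (sample_path w) t i) = (\<Sum>i<N. error (history_path (history t w)) t i)"
    by (rule sum.cong) (use state_path_eq_history_path[of w t] in auto)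
  then show ?thesis unfolding avg_error_def by simp
qed

lemma node_samples_current: "i < N \<Longrightarrow> node_samples t (current t w) i = \<xi> t i w"
  by (simp add: node_samples_def current_def present_def coord_def)

lemma state_measurable_past:
  "(\<lambda>x. iterate (history_path x) t) \<in> borel_measurable (past_space t)
    \<and> (\<lambda>x. momentum (history_path x) t) \<in> borel_measurable (past_space t) \<and>
   (\<lambda>x. avg_error (history_path x) t) \<in> borel_measurable (past_space t)"
proof -
  have "(\<lambda>x. iterate (history_path x) t) \<in> borel_measurable (past_space t)
    \<and> (\<lambda>x. prev_Q (history_path x) t) \<in> borel_measurable (past_space t) \<and>
     (\<lambda>x. momentum (history_path x) t) \<in> borel_measurable (past_space t)
       \<and> (\<forall>i<N. (\<lambda>x. error (history_path x) t i)
       \<in> borel_measurable (past_space t))"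
  proof (rule state_measurable[OF gF_measurable qr_measurable svd_measurable])
    fix s i assume "s < t" "i < N"
    then have "(\<lambda>x. x (s, i)) \<in> measurable (past_space t) (coord_space (s, i))"
      unfolding past_space_def by (intro measurable_component_singleton) (auto simp: past_def)
    then show "(\<lambda>x. history_path x s i) \<in> measurable (past_space t) (D i)"
      by (simp add: history_path_def coord_space_def)
  qed auto
  then show ?thesis unfolding avg_error_def
    by (auto intro!: borel_measurable_scaleR borel_measurable_sum)
qed

lemma state_measurable_path:
  shows "(\<lambda>w. iterate (sample_path w) t) \<in> borel_measurable M"
    and "(\<lambda>w. momentum (sample_path w) t) \<in> borel_measurable M"
    and "(\<lambda>w. avg_error (sample_path w) t) \<in> borel_measurable M"
    and "(\<lambda>w. stoch_grad (sample_path w) t) \<in> borel_measurable M"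
proof -
  have state: "(\<lambda>w. iterate (sample_path w) t) \<in> borel_measurable M
    \<and> (\<lambda>w. prev_Q (sample_path w) t) \<in> borel_measurable M
    \<and> (\<lambda>w. momentum (sample_path w) t) \<in> borel_measurable M
    \<and> (\<forall>i<N. (\<lambda>w. error (sample_path w) t i) \<in> borel_measurable M)"
    by (rule state_measurable[OF gF_measurable qr_measurable svd_measurable])
      (auto simp: sample_path_def sample_measurable)
  then show "(\<lambda>w. iterate (sample_path w) t) \<in> borel_measurable M"
    and "(\<lambda>w. momentum (sample_path w) t) \<in> borel_measurable M"
    and "(\<lambda>w. avg_error (sample_path w) t) \<in> borel_measurable M"
    unfolding avg_error_def by (auto intro!: borel_measurable_scaleR borel_measurable_sum)
  have "(\<lambda>w. gF (iterate (sample_path w) t) (\<xi> t i w)) \<in> borel_measurable M" if "i < N"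
    for i
  proof -
    have "(\<lambda>w. (iterate (sample_path w) t, \<xi> t i w))
      \<in> measurable M (borel \<Otimes>\<^sub>M D i)"
      using state that sample_measurable by (intro measurable_Pair) auto
    from measurable_comp[OF this gF_measurable[OF that]] show ?thesis
      by (simp add: comp_def)
  qed
  then show "(\<lambda>w. stoch_grad (sample_path w) t) \<in> borel_measurable M"
    unfolding stoch_grad_def by (auto intro!: borel_measurable_scaleR borel_measurable_sum simp:
      sample_path_def)
qed

lemma prob_space_past: "prob_space (past_space t)"
  unfolding past_space_def using nodes by (intro prob_space_PiM prob_space_coord_space)
    (auto simp: past_def)

lemma prob_space_present: "prob_space (present_space t)"
  unfolding present_space_def by (intro prob_space_PiM prob_space_coord_space) (auto simp: present_def)

lemma history_current_measurable: "(\<lambda>w. (history t w, current t w))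
  \<in> measurable M (past_space t \<Otimes>\<^sub>M present_space t)"
  using history_measurable current_measurable by (intro measurable_Pair)

lemma nn_integral_history_current:
  assumes F: "F \<in> borel_measurable (past_space t \<Otimes>\<^sub>M present_space t)"
  shows "(\<integral>\<^sup>+w. F (history t w, current t w) \<partial>M)
    = (\<integral>\<^sup>+x. (\<integral>\<^sup>+y. F (x, y) \<partial>present_space t)
    \<partial>past_space t)"
proof -
  interpret A: prob_space "past_space t" by (rule prob_space_past)
  interpret B: prob_space "present_space t" by (rule prob_space_present)
  interpret AB: pair_prob_space "past_space t" "present_space t" ..
  have "(\<integral>\<^sup>+w. F (history t w, current t w) \<partial>M)
    = (\<integral>\<^sup>+p. F p \<partial>distr M (past_space t \<Otimes>\<^sub>M present_space t)
    (\<lambda>w. (history t w, current t w)))"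
    using F by (subst nn_integral_distr[OF history_current_measurable]) auto
  also have "\<dots> = (\<integral>\<^sup>+p. F p
    \<partial>(past_space t \<Otimes>\<^sub>M present_space t))" by (simp add: distr_history_current)
  also have "\<dots> = (\<integral>\<^sup>+x. (\<integral>\<^sup>+y. F (x, y) \<partial>present_space t)
    \<partial>past_space t)"
    using B.nn_integral_fst[OF F] by simp
  finally show ?thesis .
qed

lemma integral_history_current:
  fixes F :: "_ \<Rightarrow> real"
  assumes F: "F \<in> borel_measurable (past_space t \<Otimes>\<^sub>M present_space t)"
    and int: "integrable M (\<lambda>w. F (history t w, current t w))"
  shows "(\<integral>w. F (history t w, current t w) \<partial>M)
    = (\<integral>x. (\<integral>y. F (x, y) \<partial>present_space t) \<partial>past_space t)"
proof -
  interpret A: prob_space "past_space t" by (rule prob_space_past)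
  interpret B: prob_space "present_space t" by (rule prob_space_present)
  interpret AB: pair_prob_space "past_space t" "present_space t" ..
  have intF: "integrable (past_space t \<Otimes>\<^sub>M present_space t) F"
    using integrable_distr_eq[OF history_current_measurable F] int distr_history_current by simp
  have "(\<integral>w. F (history t w, current t w) \<partial>M)
    = integral\<^sup>L (distr M (past_space t \<Otimes>\<^sub>M present_space t)
    (\<lambda>w. (history t w, current t w))) F"
    using integral_distr[OF history_current_measurable F] by simp
  also have "\<dots> = integral\<^sup>L (past_space t \<Otimes>\<^sub>M present_space t) F"
    by (simp add: distr_history_current)
  also have "\<dots> = (\<integral>x. (\<integral>y. F (x, y) \<partial>present_space t)
    \<partial>past_space t)"
    by (rule AB.integral_fst'[OF intF, symmetric])
  finally show ?thesis .
qed

definition avg_oracle where "avg_oracle X z = (1 / real N) *\<^sub>R (\<Sum>i<N. gF X (z i))"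

lemma gF_measurable_sample: "i < N \<Longrightarrow> gF X \<in> borel_measurable (D i)"
proof -
  assume i: "i < N"
  have "(\<lambda>z. (X, z)) \<in> measurable (D i) (borel \<Otimes>\<^sub>M D i)"
    by (intro measurable_Pair measurable_const measurable_ident) auto
  from measurable_comp[OF this gF_measurable[OF i]] show ?thesis by (simp add: comp_def)
qed

lemma avg_oracle_measurable:
  assumes X: "X \<in> borel_measurable \<Omega>" and Z: "\<And>i. i < N
    \<Longrightarrow> (\<lambda>w. Z w i) \<in> measurable \<Omega> (D i)"
  shows "(\<lambda>w. avg_oracle (X w) (Z w)) \<in> borel_measurable \<Omega>"
proof -
  have "(\<lambda>w. gF (X w) (Z w i)) \<in> borel_measurable \<Omega>" if i: "i < N" for i
  proof -
    have "(\<lambda>w. (X w, Z w i)) \<in> measurable \<Omega> (borel \<Otimes>\<^sub>M D i)"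
      using X Z[OF i] by (intro measurable_Pair)
    from measurable_comp[OF this gF_measurable[OF i]] show ?thesis by (simp add: comp_def)
  qed
  then show ?thesis unfolding avg_oracle_def by (auto intro!: borel_measurable_scaleR borel_measurable_sum)
qed

lemma stoch_grad_eq_avg_oracle: "stoch_grad (sample_path w) t
  = avg_oracle (iterate (history_path (history t w)) t) (node_samples t (current t w))"
proof -
  have "(\<Sum>i<N. gF (iterate (sample_path w) t) (sample_path w t i))
    = (\<Sum>i<N. gF (iterate (history_path (history t w)) t) (node_samples t (current t w) i))"
    by (rule sum.cong) (use state_path_eq_history_path[of w t] node_samples_current in \<open>auto simp:
      sample_path_def\<close>)
  then show ?thesis unfolding stoch_grad_def avg_oracle_def by simp
qed

lemma past_present_measurable:
  "(\<lambda>p. avg_oracle (iterate (history_path (fst p)) t) (node_samples t (snd p)))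
    \<in> borel_measurable (past_space t \<Otimes>\<^sub>M present_space t)"
  "(\<lambda>p. iterate (history_path (fst p)) t)
    \<in> borel_measurable (past_space t \<Otimes>\<^sub>M present_space t)"
  "(\<lambda>p. momentum (history_path (fst p)) t)
    \<in> borel_measurable (past_space t \<Otimes>\<^sub>M present_space t)"
  "(\<lambda>p. avg_error (history_path (fst p)) t)
    \<in> borel_measurable (past_space t \<Otimes>\<^sub>M present_space t)"
proof -
  show X: "(\<lambda>p. iterate (history_path (fst p)) t)
    \<in> borel_measurable (past_space t \<Otimes>\<^sub>M present_space t)"
    using measurable_compose[OF measurable_fst] state_measurable_past by blast
  show "(\<lambda>p. momentum (history_path (fst p)) t)
    \<in> borel_measurable (past_space t \<Otimes>\<^sub>M present_space t)"
    using measurable_compose[OF measurable_fst] state_measurable_past by blast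
  show "(\<lambda>p. avg_error (history_path (fst p)) t)
    \<in> borel_measurable (past_space t \<Otimes>\<^sub>M present_space t)"
    using measurable_compose[OF measurable_fst] state_measurable_past by blast
  show "(\<lambda>p. avg_oracle (iterate (history_path (fst p)) t) (node_samples t (snd p)))
    \<in> borel_measurable (past_space t \<Otimes>\<^sub>M present_space t)"
  proof (rule avg_oracle_measurable[OF X])
    fix i assume i: "i < N"
    have "(\<lambda>y. y (t, i)) \<in> measurable (present_space t) (coord_space (t, i))"
      unfolding present_space_def using i by (intro measurable_component_singleton) (auto simp: present_def)
    then have "(\<lambda>y. node_samples t y i) \<in> measurable (present_space t) (D i)"
      using i by (simp add: node_samples_def coord_space_def)
    then show "(\<lambda>p. node_samples t (snd p) i)
      \<in> measurable (past_space t \<Otimes>\<^sub>M present_space t) (D i)"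
      by (rule measurable_compose[OF measurable_snd])
  qed
qed

lemma expectation_norm_stoch_grad_le:
  shows "integrable M (\<lambda>w. (norm (stoch_grad (sample_path w) t))\<^sup>2)"
    and "(\<integral>w. (norm (stoch_grad (sample_path w) t))\<^sup>2 \<partial>M) \<le> G2"
proof -
  interpret A: prob_space "past_space t" by (rule prob_space_past)
  define F where "F p = ennreal ((norm (avg_oracle (iterate (history_path (fst p)) t)
    (node_samples t (snd p))))\<^sup>2)" for p
  have Fm: "F \<in> borel_measurable (past_space t \<Otimes>\<^sub>M present_space t)" unfolding F_def
    using past_present_measurable(1) by measurable
  have "(\<integral>\<^sup>+w. ennreal ((norm (stoch_grad (sample_path w) t))\<^sup>2) \<partial>M)
    = (\<integral>\<^sup>+w. F (history t w, current t w) \<partial>M)"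
    by (simp add: F_def stoch_grad_eq_avg_oracle)
  also have "\<dots> = (\<integral>\<^sup>+x. (\<integral>\<^sup>+y. F (x, y) \<partial>present_space t)
    \<partial>past_space t)" by (rule nn_integral_history_current[OF Fm])
  also have "\<dots> \<le> (\<integral>\<^sup>+x. ennreal G2 \<partial>past_space t)"
  proof (rule nn_integral_mono)
    fix x
    have "(\<integral>\<^sup>+y. F (x, y) \<partial>present_space t)
      = (\<integral>\<^sup>+z. ennreal ((norm (avg_oracle (iterate (history_path x) t) z))\<^sup>2)
      \<partial>distr (present_space t) nodes_space (node_samples t))"
    proof (subst nn_integral_distr[OF node_samples_measurable])
      have "(\<lambda>z. avg_oracle (iterate (history_path x) t) z) \<in> borel_measurable nodes_space"
        by (rule avg_oracle_measurable) (auto simp: nodes_space_def intro!: measurable_component_singleton)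
      then show "(\<lambda>z. ennreal ((norm (avg_oracle (iterate (history_path x) t) z))\<^sup>2))
        \<in> borel_measurable (distr (present_space t) nodes_space (node_samples t))"
        by simp
    qed (simp add: F_def)
    also have "\<dots> = (\<integral>\<^sup>+z. ennreal
      ((norm (avg_oracle (iterate (history_path x) t) z))\<^sup>2) \<partial>nodes_space)"
      by (simp only: distr_node_samples)
    also have "\<dots> \<le> ennreal G2" unfolding avg_oracle_def nodes_space_def by (rule second_moment)
    finally show "(\<integral>\<^sup>+y. F (x, y) \<partial>present_space t) \<le> ennreal G2" .
  qed
  also have "\<dots> = ennreal G2" by (simp add: A.emeasure_space_1)
  finally have b: "(\<integral>\<^sup>+w. ennreal ((norm (stoch_grad (sample_path w) t))\<^sup>2)
    \<partial>M) \<le> ennreal G2" .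
  have meas: "(\<lambda>w. stoch_grad (sample_path w) t) \<in> borel_measurable M"
    using state_measurable_path by blast
  from nn_integral_power2_norm_leD[OF meas b second_moment_nonneg]
  show "integrable M (\<lambda>w. (norm (stoch_grad (sample_path w) t))\<^sup>2)"
    and "(\<integral>w. (norm (stoch_grad (sample_path w) t))\<^sup>2 \<partial>M) \<le> G2" .
qed

lemma avg_oracle_minus_grad: "avg_oracle X z - grad_f X
  = (1 / real N) *\<^sub>R (\<Sum>i<N. gF X (z i) - grad_fi i X)"
  unfolding avg_oracle_def grad_avg by (simp add: sum_subtractf scaleR_diff_right)

lemma distr_nodes_component: "i < N \<Longrightarrow> distr nodes_space (D i) (\<lambda>z. z i) = D i"
  unfolding nodes_space_def by (rule distr_PiM_component[OF prob_D]) auto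

lemma nodes_component_measurable: "i < N \<Longrightarrow> (\<lambda>z. z i)
  \<in> measurable nodes_space (D i)"
  unfolding nodes_space_def by (rule measurable_component_singleton) auto

lemma centred_sample:
  assumes i: "i < N"
  shows "(\<lambda>z. gF X z - grad_fi i X) \<in> borel_measurable (D i)"
    and "integrable (D i) (\<lambda>z. gF X z - grad_fi i X)"
    and "(\<integral>z. gF X z - grad_fi i X \<partial>D i) = 0"
proof -
  interpret Di: prob_space "D i" by (rule prob_D[OF i])
  show "(\<lambda>z. gF X z - grad_fi i X) \<in> borel_measurable (D i)"
    using gF_measurable_sample[OF i] by measurable
  show "integrable (D i) (\<lambda>z. gF X z - grad_fi i X)"
    using unbiased[OF i] by auto
  show "(\<integral>z. gF X z - grad_fi i X \<partial>D i) = 0"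
    using unbiased[OF i, of X] by (simp add: Bochner_Integration.integral_diff Di.prob_space)
qed

lemma nodes_variance_le: "(\<integral>\<^sup>+z. ennreal ((norm (avg_oracle X z - grad_f X))\<^sup>2)
  \<partial>nodes_space) \<le> ennreal (\<sigma>2 / real N)"
proof -
  have vp: "(\<integral>\<^sup>+z. ennreal ((norm (\<Sum>i<N. gF X (z i) - grad_fi i X))\<^sup>2)
    \<partial>nodes_space) \<le> ennreal (real N * \<sigma>2)"
    using PiM_nn_integral_norm_sum_le[of "{..<N}" D "\<lambda>i z. gF X z - grad_fi i X" \<sigma>2]
      prob_D centred_sample variance variance_nonneg
    by (simp add: nodes_space_def)
  have m: "(\<lambda>z. ennreal ((norm (\<Sum>i<N. gF X (z i) - grad_fi i X))\<^sup>2))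
    \<in> borel_measurable nodes_space"
  proof -
    have "(\<lambda>z. gF X (z i) - grad_fi i X) \<in> borel_measurable nodes_space" if "i < N" for i
      using measurable_compose[OF nodes_component_measurable[OF that] centred_sample(1)[OF that]] .
    then show ?thesis by (auto intro!: borel_measurable_sum)
  qed
  have "(\<integral>\<^sup>+z. ennreal ((norm (avg_oracle X z - grad_f X))\<^sup>2) \<partial>nodes_space)
      = (\<integral>\<^sup>+z. ennreal ((1 / real N)\<^sup>2)
        * ennreal ((norm (\<Sum>i<N. gF X (z i) - grad_fi i X))\<^sup>2) \<partial>nodes_space)"
  proof (rule nn_integral_cong)
    fix z
    have "(norm ((1 / real N) *\<^sub>R (\<Sum>i<N. gF X (z i) - grad_fi i X)))\<^sup>2
      = (1 / real N)\<^sup>2 * (norm (\<Sum>i<N. gF X (z i) - grad_fi i X))\<^sup>2"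
      by (simp add: power_divide)
    then show "ennreal ((norm (avg_oracle X z - grad_f X))\<^sup>2) = ennreal ((1 / real N)\<^sup>2)
      * ennreal ((norm (\<Sum>i<N. gF X (z i) - grad_fi i X))\<^sup>2)"
      unfolding avg_oracle_minus_grad by (simp add: ennreal_mult[symmetric])
  qed
  also have "\<dots> = ennreal ((1 / real N)\<^sup>2)
    * (\<integral>\<^sup>+z. ennreal ((norm (\<Sum>i<N. gF X (z i) - grad_fi i X))\<^sup>2)
    \<partial>nodes_space)"
    by (rule nn_integral_cmult[OF m])
  also have "\<dots> \<le> ennreal ((1 / real N)\<^sup>2) * ennreal (real N * \<sigma>2)"
    by (rule mult_left_mono[OF vp]) simp
  also have "\<dots> = ennreal (\<sigma>2 / real N)"
    using nodes variance_nonneg by (simp add: ennreal_mult''[symmetric] power2_eq_square)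
  finally show ?thesis .
qed

lemma nodes_mean_eq_0: "integrable nodes_space (\<lambda>z. avg_oracle X z - grad_f X)
  \<and> (\<integral>z. avg_oracle X z - grad_f X \<partial>nodes_space) = 0"
proof -
  have each: "integrable nodes_space (\<lambda>z. gF X (z i) - grad_fi i X)
    \<and> (\<integral>z. gF X (z i) - grad_fi i X \<partial>nodes_space) = 0" if i: "i < N" for i
  proof -
    have "integrable nodes_space (\<lambda>z. gF X (z i) - grad_fi i X)"
      using integrable_distr_eq[OF nodes_component_measurable[OF i] centred_sample(1)[OF i]]
        distr_nodes_component[OF i] centred_sample(2)[OF i] by simp
    moreover have "(\<integral>z. gF X (z i) - grad_fi i X \<partial>nodes_space) = 0"
      using integral_distr[OF nodes_component_measurable[OF i] centred_sample(1)[OF i]]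
        distr_nodes_component[OF i] centred_sample(3)[OF i] by simp
    ultimately show ?thesis ..
  qed
  have "integrable nodes_space (\<lambda>z. (1 / real N) *\<^sub>R (\<Sum>i<N. gF X (z i) - grad_fi i X))"
    using each by (intro integrable_scaleR_right Bochner_Integration.integrable_sum) auto
  moreover have "(\<integral>z. (1 / real N) *\<^sub>R (\<Sum>i<N. gF X (z i) - grad_fi i X)
    \<partial>nodes_space) = 0"
  proof -
    have "(\<integral>z. (\<Sum>i<N. gF X (z i) - grad_fi i X) \<partial>nodes_space)
      = (\<Sum>i<N. (\<integral>z. gF X (z i) - grad_fi i X \<partial>nodes_space))"
      using each by (intro Bochner_Integration.integral_sum) auto
    also have "\<dots> = 0" using each by simp
    finally show ?thesis by simp
  qed
  ultimately show ?thesis unfolding avg_oracle_minus_grad by simp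
qed

lemma expectation_noise_le:
  shows "integrable M (\<lambda>w. (norm (stoch_grad (sample_path w) t
    - grad_f (iterate (sample_path w) t)))\<^sup>2)"
    and "(\<integral>w. (norm (stoch_grad (sample_path w) t
      - grad_f (iterate (sample_path w) t)))\<^sup>2 \<partial>M) \<le> \<sigma>2 / real N"
proof -
  interpret A: prob_space "past_space t" by (rule prob_space_past)
  define F where "F p = ennreal ((norm (avg_oracle (iterate (history_path (fst p)) t)
    (node_samples t (snd p)) - grad_f (iterate (history_path (fst p)) t)))\<^sup>2)" for p
  have Fm: "F \<in> borel_measurable (past_space t \<Otimes>\<^sub>M present_space t)" unfolding F_def
    using past_present_measurable(1,2) measurable_compose[OF past_present_measurable(2) grad_measurable]
      by measurable
  have "(\<integral>\<^sup>+w. ennreal ((norm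
    (stoch_grad (sample_path w) t - grad_f (iterate (sample_path w) t)))\<^sup>2) \<partial>M)
    = (\<integral>\<^sup>+w. F (history t w, current t w) \<partial>M)"
    using state_path_eq_history_path by (simp add: F_def stoch_grad_eq_avg_oracle)
  also have "\<dots> = (\<integral>\<^sup>+x. (\<integral>\<^sup>+y. F (x, y) \<partial>present_space t)
    \<partial>past_space t)" by (rule nn_integral_history_current[OF Fm])
  also have "\<dots> \<le> (\<integral>\<^sup>+x. ennreal (\<sigma>2 / real N) \<partial>past_space t)"
  proof (rule nn_integral_mono)
    fix x
    have gmm: "(\<lambda>z. avg_oracle (iterate (history_path x) t) z) \<in> borel_measurable nodes_space"
      by (rule avg_oracle_measurable) (auto simp: nodes_space_def intro!: measurable_component_singleton)
    have "(\<integral>\<^sup>+y. F (x, y) \<partial>present_space t)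
      = (\<integral>\<^sup>+z. ennreal ((norm
      (avg_oracle (iterate (history_path x) t) z - grad_f (iterate (history_path x) t)))\<^sup>2)
      \<partial>distr (present_space t) nodes_space (node_samples t))"
      by (subst nn_integral_distr[OF node_samples_measurable]) (use gmm in \<open>auto simp: F_def\<close>)
    also have "\<dots> = (\<integral>\<^sup>+z. ennreal
      ((norm (avg_oracle (iterate (history_path x) t) z - grad_f (iterate (history_path x) t)))\<^sup>2)
      \<partial>nodes_space)" by (simp only: distr_node_samples)
    also have "\<dots> \<le> ennreal (\<sigma>2 / real N)" by (rule nodes_variance_le)
    finally show "(\<integral>\<^sup>+y. F (x, y) \<partial>present_space t)
      \<le> ennreal (\<sigma>2 / real N)" .
  qed
  also have "\<dots> = ennreal (\<sigma>2 / real N)" by (simp add: A.emeasure_space_1)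
  finally have b: "(\<integral>\<^sup>+w. ennreal
    ((norm (stoch_grad (sample_path w) t - grad_f (iterate (sample_path w) t)))\<^sup>2) \<partial>M)
    \<le> ennreal (\<sigma>2 / real N)" .
  have meas: "(\<lambda>w. stoch_grad (sample_path w) t - grad_f (iterate (sample_path w) t))
    \<in> borel_measurable M"
  proof -
    have a: "(\<lambda>w. stoch_grad (sample_path w) t)
      \<in> borel_measurable M" "(\<lambda>w. iterate (sample_path w) t) \<in> borel_measurable M"
      using state_measurable_path by blast+
    show ?thesis using a(1) measurable_compose[OF a(2) grad_measurable] by (rule borel_measurable_diff)
  qed
  from nn_integral_power2_norm_leD[OF meas b] variance_nonneg
  show "integrable M (\<lambda>w. (norm (stoch_grad (sample_path w) t
    - grad_f (iterate (sample_path w) t)))\<^sup>2)"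
    and "(\<integral>w. (norm (stoch_grad (sample_path w) t
      - grad_f (iterate (sample_path w) t)))\<^sup>2 \<partial>M) \<le> \<sigma>2 / real N"
    by auto
qed

lemma expectation_inner_noise_eq_0:
  fixes \<Phi> :: "(real^('n::{finite,wellorder})^('m::{finite,wellorder})) \<times>
    (real^('n::{finite,wellorder})^('m::{finite,wellorder})) \<times>
    (real^('n::{finite,wellorder})^('m::{finite,wellorder}))
    \<Rightarrow> real^('n::{finite,wellorder})^('m::{finite,wellorder})"
  assumes \<Phi>m: "\<Phi> \<in> borel_measurable borel" and \<Phi>b: "\<And>p. norm (\<Phi> p) \<le> B"
  shows "integrable M (\<lambda>w. \<Phi> (iterate (sample_path w) t, momentum (sample_path w) t,
    avg_error (sample_path w) t) \<bullet> (stoch_grad (sample_path w) t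
    - grad_f (iterate (sample_path w) t)))"
    and "(\<integral>w. \<Phi> (iterate (sample_path w) t, momentum (sample_path w) t, avg_error
      (sample_path w) t) \<bullet> (stoch_grad (sample_path w) t - grad_f (iterate (sample_path w) t))
      \<partial>M) = 0"
proof -
  let ?V = "\<lambda>w. \<Phi> (iterate (sample_path w) t, momentum (sample_path w) t, avg_error
    (sample_path w) t)"
  let ?u = "\<lambda>w. stoch_grad (sample_path w) t - grad_f (iterate (sample_path w) t)"
  have state: "(\<lambda>w. iterate (sample_path w) t)
    \<in> borel_measurable M" "(\<lambda>w. momentum (sample_path w) t) \<in> borel_measurable M"
    "(\<lambda>w. avg_error (sample_path w) t)
      \<in> borel_measurable M" "(\<lambda>w. stoch_grad (sample_path w) t) \<in> borel_measurable M"
    using state_measurable_path by blast+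
  have Vm: "?V \<in> borel_measurable M"
    using measurable_compose[OF _ \<Phi>m] state by measurable
  have um: "?u \<in> borel_measurable M"
    using state(4) measurable_compose[OF state(1) grad_measurable] by (rule borel_measurable_diff)
  have intu: "integrable M (\<lambda>w. (norm (?u w))\<^sup>2)" using expectation_noise_le by blast
  show int: "integrable M (\<lambda>w. ?V w \<bullet> ?u w)"
  proof (rule Bochner_Integration.integrable_bound)
    show "integrable M (\<lambda>w. B\<^sup>2 + (norm (?u w))\<^sup>2)" using intu by simp
    show "(\<lambda>w. ?V w \<bullet> ?u w) \<in> borel_measurable M" using Vm um by measurable
    show "AE w in M. norm (?V w \<bullet> ?u w) \<le> norm (B\<^sup>2 + (norm (?u w))\<^sup>2)"
    proof (rule AE_I2)
      fix w
      have "norm (?V w \<bullet> ?u w) \<le> (norm (?V w))\<^sup>2 + (norm (?u w))\<^sup>2"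
        using abs_inner_le_sum_power2 by simp
      also have "(norm (?V w))\<^sup>2 \<le> B\<^sup>2"
        using \<Phi>b norm_ge_zero by (intro power_mono) auto
      finally show "norm (?V w \<bullet> ?u w) \<le> norm (B\<^sup>2 + (norm (?u w))\<^sup>2)" by simp
    qed
  qed
  interpret A: prob_space "past_space t" by (rule prob_space_past)
  define F where "F p = \<Phi> (iterate (history_path (fst p)) t, momentum (history_path (fst p)) t,
    avg_error (history_path (fst p)) t) \<bullet>
      (avg_oracle (iterate (history_path (fst p)) t) (node_samples t (snd p))
        - grad_f (iterate (history_path (fst p)) t))" for p
  have Fm: "F \<in> borel_measurable (past_space t \<Otimes>\<^sub>M present_space t)"
  proof -
    have "(\<lambda>p. \<Phi> (iterate (history_path (fst p)) t, momentum (history_path (fst p)) t,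
      avg_error (history_path (fst p)) t)) \<in> borel_measurable
      (past_space t \<Otimes>\<^sub>M present_space t)"
      using measurable_compose[OF _ \<Phi>m] past_present_measurable(2-4) by measurable
    then show ?thesis unfolding F_def
      using past_present_measurable(1,2) measurable_compose[OF past_present_measurable(2)
        grad_measurable] by measurable
  qed
  have FHC: "?V w \<bullet> ?u w = F (history t w, current t w)" for w
    using state_path_eq_history_path[of w t] avg_error_path_eq_history_path[of w t]
      by (simp add: F_def stoch_grad_eq_avg_oracle)
  have "(\<integral>w. ?V w \<bullet> ?u w \<partial>M)
    = (\<integral>w. F (history t w, current t w) \<partial>M)" by (simp add: FHC)
  also have "\<dots> = (\<integral>x. (\<integral>y. F (x, y) \<partial>present_space t)
    \<partial>past_space t)"
    by (rule integral_history_current[OF Fm]) (use int in \<open>simp add: FHC\<close>)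
  also have "\<dots> = (\<integral>x. 0 \<partial>past_space t)"
  proof (rule Bochner_Integration.integral_cong[OF refl])
    fix x
    let ?v = "\<Phi> (iterate (history_path x) t, momentum (history_path x) t, avg_error
      (history_path x) t)" and ?X = "iterate (history_path x) t"
    have gmm: "(\<lambda>z. avg_oracle ?X z) \<in> borel_measurable nodes_space"
      by (rule avg_oracle_measurable) (auto simp: nodes_space_def intro!: measurable_component_singleton)
    have hm: "(\<lambda>z. ?v \<bullet> (avg_oracle ?X z - grad_f ?X))
      \<in> borel_measurable nodes_space" using gmm by measurable
    have "(\<integral>y. F (x, y) \<partial>present_space t)
      = (\<integral>z. ?v \<bullet> (avg_oracle ?X z - grad_f ?X) \<partial>distr (present_space t)
      nodes_space (node_samples t))"
      using integral_distr[OF node_samples_measurable hm] by (simp add: F_def)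
    also have "\<dots> = (\<integral>z. ?v \<bullet> (avg_oracle ?X z - grad_f ?X)
      \<partial>nodes_space)" by (simp only: distr_node_samples)
    also have "\<dots> = ?v \<bullet> (\<integral>z. avg_oracle ?X z - grad_f ?X \<partial>nodes_space)"
      using nodes_mean_eq_0[of ?X] by (intro integral_inner_right) auto
    also have "\<dots> = 0" using nodes_mean_eq_0[of ?X] by simp
    finally show "(\<integral>y. F (x, y) \<partial>present_space t) = 0" .
  qed
  also have "\<dots> = 0" by simp
  finally show "(\<integral>w. ?V w \<bullet> ?u w \<partial>M) = 0" .
qed

end

context powersgd
begin

lemma descent_along_virtual:
  fixes f :: "real^('n::{finite,wellorder})^('m::{finite,wellorder}) \<Rightarrow> real"
  assumes f_grad: "\<And>X. (f has_derivative (\<lambda>H. grad_f X \<bullet> H)) (at X)"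
    and f_smooth: "\<And>X Y. norm (grad_f X - grad_f Y) \<le> L * norm (X - Y)"
    and step: "\<eta> = \<gamma> * (1 - \<mu>)" "0 \<le> \<gamma>" "L * \<gamma> \<le> 1 / 2"
  shows "\<gamma> / 4 * (norm (grad_f (iterate xs t)))\<^sup>2
    \<le> f (virtual \<gamma> xs t) - f (virtual \<gamma> xs (Suc t))
      + \<gamma> * L\<^sup>2 / 2 * (norm (iterate xs t - virtual \<gamma> xs t))\<^sup>2
      + L * \<gamma>\<^sup>2 / 2 * (norm (stoch_grad xs t - grad_f (iterate xs t)))\<^sup>2
      - \<gamma> * ((grad_f (virtual \<gamma> xs t) - (L * \<gamma>) *\<^sub>R grad_f (iterate xs t))
          \<bullet> (stoch_grad xs t - grad_f (iterate xs t)))"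
proof -
  let ?X = "iterate xs t" and ?Z = "virtual \<gamma> xs t" and ?g = "stoch_grad xs t"
  have "f (virtual \<gamma> xs (Suc t)) \<le> f ?Z + grad_f ?Z
    \<bullet> (- (\<gamma> *\<^sub>R (grad_f ?X + (?g - grad_f ?X))))
      + L / 2 * (norm (\<gamma> *\<^sub>R (grad_f ?X + (?g - grad_f ?X))))\<^sup>2"
    using Lipschitz_gradient_upper_bound[OF f_grad f_smooth, of "virtual \<gamma> xs (Suc t)" ?Z]
    by (simp add: virtual_Suc[OF step(1)])
  moreover have "norm (grad_f ?Z - grad_f ?X) \<le> L * norm (?X - ?Z)"
    using f_smooth[of ?Z ?X] by (simp add: norm_minus_commute)
  ultimately show ?thesis
    using step(2,3) by (rule descent_step_bound)
qed

end

context powersgd_sampling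
begin

lemma expectation_iterate_minus_virtual_le:
  assumes W: "W = total_lag_weight \<tau> (real CARD('r::{finite,wellorder})
    / real CARD('n::{finite,wellorder})) \<mu>"
  shows "integrable M (\<lambda>w. (norm (iterate (sample_path w) t
    - virtual \<gamma> (sample_path w) t))\<^sup>2)"
    and "(\<integral>w. (norm (iterate (sample_path w) t - virtual \<gamma> (sample_path w) t))\<^sup>2
      \<partial>M) \<le> \<gamma>\<^sup>2 * W\<^sup>2 * G2"
proof -
  define q where "q = sqrt (1 - real CARD('r::{finite,wellorder}) / real CARD('n::{finite,wellorder}))"
  have q: "0 \<le> q" "q < 1"
    using rank by (simp_all add: q_def)
  have W_sum: "(\<Sum>s<t. lag_weight q t s) \<le> W"
    using sum_lag_weight_le[OF q] by (simp add: W q_def total_lag_weight_def)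
  have "0 \<le> (\<Sum>s<t. lag_weight q t s)"
    by (intro sum_nonneg lag_weight_nonneg[OF q(1)])
  then have W_nonneg: "0 \<le> W"
    using W_sum by linarith
  define B where "B = (\<lambda>w. \<gamma>\<^sup>2 * W
    * (\<Sum>s<t. lag_weight q t s * (norm (stoch_grad (sample_path w) s))\<^sup>2))"
  have pathwise: "(norm (iterate (sample_path w) t - virtual \<gamma> (sample_path w) t))\<^sup>2
    \<le> B w" for w
    unfolding B_def by (rule norm_iterate_minus_virtual_le[OF q_def W_sum])
  have B: "integrable M B"
    unfolding B_def using expectation_norm_stoch_grad_le
    by (intro integrable_mult_right Bochner_Integration.integrable_sum) auto
  have "(\<lambda>w. (norm (iterate (sample_path w) t - virtual \<gamma> (sample_path w) t))\<^sup>2)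
    \<in> borel_measurable M"
    using state_measurable_path[of t] unfolding virtual_def by measurable
  then show integrable: "integrable M (\<lambda>w.
    (norm (iterate (sample_path w) t - virtual \<gamma> (sample_path w) t))\<^sup>2)"
    using pathwise by (intro Bochner_Integration.integrable_bound[OF B])
      (auto intro: order_trans abs_ge_self)
  have "(\<integral>w. (norm (iterate (sample_path w) t - virtual \<gamma> (sample_path w) t))\<^sup>2
    \<partial>M) \<le> integral\<^sup>L M B"
    using integrable B pathwise by (rule integral_mono)
  also have "\<dots> = \<gamma>\<^sup>2 * W *
    (\<Sum>s<t. lag_weight q t s * (\<integral>w. (norm (stoch_grad (sample_path w) s))\<^sup>2
    \<partial>M))"
    using expectation_norm_stoch_grad_le(1)
    by (simp add: B_def Bochner_Integration.integral_sum Bochner_Integration.integral_mult_right_zero)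
  also have "\<dots> \<le> \<gamma>\<^sup>2 * W * (\<Sum>s<t. lag_weight q t s * G2)"
    using expectation_norm_stoch_grad_le lag_weight_nonneg[OF q(1)] W_nonneg
    by (intro mult_left_mono sum_mono) auto
  also have "\<dots> \<le> \<gamma>\<^sup>2 * W * (W * G2)"
    using W_sum W_nonneg second_moment_nonneg
    by (intro mult_left_mono) (auto simp: sum_distrib_right[symmetric] intro: mult_right_mono)
  finally show "(\<integral>w. (norm (iterate (sample_path w) t
    - virtual \<gamma> (sample_path w) t))\<^sup>2 \<partial>M) \<le> \<gamma>\<^sup>2 * W\<^sup>2 * G2"
    by (simp add: power2_eq_square mult_ac)
qed

lemma expectation_inner_noise_virtual_eq_0:
  assumes grad_bounded: "\<And>X. norm (grad_f X) \<le> \<omega>"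
  shows "integrable M (\<lambda>w. (grad_f (virtual \<gamma> (sample_path w) t)
    - c *\<^sub>R grad_f (iterate (sample_path w) t))
      \<bullet> (stoch_grad (sample_path w) t - grad_f (iterate (sample_path w) t)))"
    and "(\<integral>w. (grad_f (virtual \<gamma> (sample_path w) t)
      - c *\<^sub>R grad_f (iterate (sample_path w) t))
      \<bullet> (stoch_grad (sample_path w) t - grad_f (iterate (sample_path w) t)) \<partial>M) = 0"
proof -
  define \<Phi> :: "(real^('n::{finite,wellorder})^('m::{finite,wellorder})) \<times>
    (real^('n::{finite,wellorder})^('m::{finite,wellorder}))
      \<times> (real^('n::{finite,wellorder})^('m::{finite,wellorder}))
        \<Rightarrow> real^('n::{finite,wellorder})^('m::{finite,wellorder})"
    where "\<Phi> p = grad_f (fst p - (\<gamma> * \<mu>) *\<^sub>R fst (snd p)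
      - \<gamma> *\<^sub>R snd (snd p)) - c *\<^sub>R grad_f (fst p)" for p
  have "(\<lambda>p::(real^('n::{finite,wellorder})^('m::{finite,wellorder})) \<times>
    (real^('n::{finite,wellorder})^('m::{finite,wellorder}))
      \<times> (real^('n::{finite,wellorder})^('m::{finite,wellorder})). fst p
        - (\<gamma> * \<mu>) *\<^sub>R fst (snd p) - \<gamma> *\<^sub>R snd (snd p))
      \<in> borel_measurable borel"
    "(\<lambda>p::(real^('n::{finite,wellorder})^('m::{finite,wellorder})) \<times>
      (real^('n::{finite,wellorder})^('m::{finite,wellorder}))
      \<times> (real^('n::{finite,wellorder})^('m::{finite,wellorder})). fst p)
        \<in> borel_measurable borel"
    by (intro borel_measurable_continuous_onI continuous_intros)+
  then have measurable: "\<Phi> \<in> borel_measurable borel"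
    unfolding \<Phi>_def using grad_measurable by measurable
  have bounded: "norm (\<Phi> p) \<le> \<omega> + \<bar>c\<bar> * \<omega>" for p
    unfolding \<Phi>_def using grad_bounded
    by (intro order_trans[OF norm_triangle_ineq4] add_mono) (auto intro: mult_left_mono)
  show "integrable M (\<lambda>w. (grad_f (virtual \<gamma> (sample_path w) t)
    - c *\<^sub>R grad_f (iterate (sample_path w) t))
      \<bullet> (stoch_grad (sample_path w) t - grad_f (iterate (sample_path w) t)))"
    and "(\<integral>w. (grad_f (virtual \<gamma> (sample_path w) t)
      - c *\<^sub>R grad_f (iterate (sample_path w) t))
      \<bullet> (stoch_grad (sample_path w) t - grad_f (iterate (sample_path w) t)) \<partial>M) = 0"
    using expectation_inner_noise_eq_0[OF measurable bounded, of t]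
      by (simp_all add: \<Phi>_def virtual_def)
qed

lemma average_grad_norm_le:
  fixes f :: "real^('n::{finite,wellorder})^('m::{finite,wellorder}) \<Rightarrow> real"
  assumes f_grad: "\<And>X. (f has_derivative (\<lambda>H. grad_f X \<bullet> H)) (at X)"
    and f_smooth: "\<And>X Y. norm (grad_f X - grad_f Y) \<le> L * norm (X - Y)"
    and f_gap: "\<And>X. f X0 - f X \<le> \<Delta>" and grad_bounded: "\<And>X. norm (grad_f X)
      \<le> \<omega>"
    and W: "W = total_lag_weight \<tau> (real CARD('r::{finite,wellorder})
      / real CARD('n::{finite,wellorder})) \<mu>"
    and step: "\<eta> = \<gamma> * (1 - \<mu>)" "0 < \<gamma>" "L * \<gamma> \<le> 1 / 2" and "0
      \<le> L" and "1 \<le> T"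
  shows "(\<Sum>t<T. \<integral>w. (norm (grad_f (iterate (sample_path w) t)))\<^sup>2 \<partial>M) / real T
    \<le> 4 * \<Delta> / (\<gamma> * real T) + 2 * L\<^sup>2 * \<gamma>\<^sup>2 * W\<^sup>2 * G2 + 2 * L
      * \<gamma> * \<sigma>2 / real N"
proof -
  interpret P: prob_space M
    by (rule prob_M)
  define a where "a t w = (norm (grad_f (iterate (sample_path w) t)))\<^sup>2" for t w
  define lag where "lag t w = (norm (iterate (sample_path w) t
    - virtual \<gamma> (sample_path w) t))\<^sup>2" for t w
  define noise where "noise t w = (norm (stoch_grad (sample_path w) t
    - grad_f (iterate (sample_path w) t)))\<^sup>2" for t w
  define cross where "cross t w = (grad_f (virtual \<gamma> (sample_path w) t)
    - (L * \<gamma>) *\<^sub>R grad_f (iterate (sample_path w) t))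
    \<bullet> (stoch_grad (sample_path w) t - grad_f (iterate (sample_path w) t))" for t w
  define e where "e t w = \<gamma> * L\<^sup>2 / 2 * lag t w + L * \<gamma>\<^sup>2 / 2 * noise t w
    - \<gamma> * cross t w" for t w
  have telescoped: "\<gamma> / 4 * (\<Sum>t<T. a t w) \<le> \<Delta> + (\<Sum>t<T. e t w)" for w
  proof -
    let ?Z = "virtual \<gamma> (sample_path w)"
    have "\<gamma> / 4 * (\<Sum>t<T. a t w) \<le> (\<Sum>t<T. (f (?Z t) - f (?Z (Suc t))) + e t w)"
      unfolding sum_distrib_left using descent_along_virtual[OF f_grad f_smooth step(1) _ step(3)] step(2)
      by (intro sum_mono) (simp add: a_def e_def lag_def noise_def cross_def algebra_simps)
    also have "\<dots> = (f (?Z 0) - f (?Z T)) + (\<Sum>t<T. e t w)"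
      using sum_lessThan_telescope'[of "\<lambda>t. f (?Z t)" T] by (simp add: sum.distrib)
    also have "f (?Z 0) = f X0"
      by (simp add: virtual_def state_0 avg_error_def)
    finally show ?thesis
      using f_gap[of "?Z T"] by simp
  qed
  have a: "integrable M (a t)" for t
  proof (rule Bochner_Integration.integrable_bound)
    show "integrable M (\<lambda>w. \<omega>\<^sup>2)"
      by simp
    show "a t \<in> borel_measurable M"
      unfolding a_def using measurable_compose[OF state_measurable_path(1) grad_measurable] by measurable
    show "AE w in M. norm (a t w) \<le> norm (\<omega>\<^sup>2)"
      using grad_bounded order_trans[OF norm_ge_zero grad_bounded] by (auto simp: a_def intro!: power_mono)
  qed
  have e: "integrable M (e t)" "(\<integral>w. e t w \<partial>M) \<le> \<gamma> * L\<^sup>2 / 2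
    * (\<gamma>\<^sup>2 * W\<^sup>2 * G2) + L * \<gamma>\<^sup>2 / 2 * (\<sigma>2 / real N)" for t
  proof -
    note lag = expectation_iterate_minus_virtual_le[OF W, where t=t and \<gamma>=\<gamma>, folded lag_def]
      and noise = expectation_noise_le[of t, folded noise_def]
      and cross = expectation_inner_noise_virtual_eq_0[OF grad_bounded, where \<gamma>=\<gamma> and c="L
        * \<gamma>" and t=t, folded cross_def]
    show "integrable M (e t)"
      unfolding e_def using lag(1) noise(1) cross(1) by simp
    have "(\<integral>w. e t w \<partial>M) = \<gamma> * L\<^sup>2 / 2
      * (\<integral>w. lag t w \<partial>M) + L * \<gamma>\<^sup>2 / 2
      * (\<integral>w. noise t w \<partial>M)"
      unfolding e_def using lag(1) noise(1) cross by simp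
    also have "\<dots> \<le> \<gamma> * L\<^sup>2 / 2 * (\<gamma>\<^sup>2 * W\<^sup>2 * G2) + L
      * \<gamma>\<^sup>2 / 2 * (\<sigma>2 / real N)"
      using lag(2) noise(2) step(2) \<open>0 \<le> L\<close> by (intro add_mono mult_left_mono) auto
    finally show "(\<integral>w. e t w \<partial>M) \<le> \<gamma> * L\<^sup>2 / 2
      * (\<gamma>\<^sup>2 * W\<^sup>2 * G2) + L * \<gamma>\<^sup>2 / 2 * (\<sigma>2 / real N)" .
  qed
  have "\<gamma> / 4 * (\<Sum>t<T. \<integral>w. a t w \<partial>M)
    = (\<integral>w. \<gamma> / 4 * (\<Sum>t<T. a t w) \<partial>M)"
    using a by simp
  also have "\<dots> \<le> (\<integral>w. \<Delta> + (\<Sum>t<T. e t w) \<partial>M)"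
    using a e(1) telescoped by (intro integral_mono) auto
  also have "\<dots> = \<Delta> + (\<Sum>t<T. \<integral>w. e t w \<partial>M)"
    using e(1) by (simp add: P.prob_space)
  also have "\<dots> \<le> \<Delta> + real T *
    (\<gamma> * L\<^sup>2 / 2 * (\<gamma>\<^sup>2 * W\<^sup>2 * G2) + L * \<gamma>\<^sup>2 / 2
    * (\<sigma>2 / real N))"
    using sum_mono[OF e(2), where K="{..<T}"] by simp
  finally have "\<gamma> / 4 * (\<Sum>t<T. \<integral>w. a t w \<partial>M)
      \<le> \<Delta> + real T * (\<gamma> * L\<^sup>2 / 2 * (\<gamma>\<^sup>2 * W\<^sup>2 * G2) + L
        * \<gamma>\<^sup>2 / 2 * (\<sigma>2 / real N))" .
  then show ?thesis
    using step(2) \<open>1 \<le> T\<close> unfolding a_def by (simp add: field_simps power2_eq_square)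
qed

end

lemma powr_one_third_cube:
  fixes a :: real
  assumes "0 \<le> a"
  shows "(a powr (1/3)) ^ 3 = a"
proof (cases "a = 0")
  case False
  then have "(a powr (1/3)) ^ 3 = a powr (of_nat 3 * (1/3))"
    by (rule powr_power)
  then show ?thesis
    using assms by simp
qed simp

lemma powr_two_thirds_cube:
  fixes a :: real
  assumes "0 \<le> a"
  shows "(a powr (2/3)) ^ 3 = a\<^sup>2"
proof (cases "a = 0")
  case False
  then have "(a powr (2/3)) ^ 3 = a powr (real 2)"
    using powr_power[of a "2/3" 3] by simp
  also have "\<dots> = a\<^sup>2"
    using assms False by (intro powr_realpow) simp
  finally show ?thesis .
qed simp

text \<open>With \<open>s = \<surd>(c/b)\<close> and \<open>\<kappa> = \<root>3(d/b)\<close>, the step \<open>\<gamma> = 1/(2L + s + \<kappa>)\<close> makes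
  \<open>c \<gamma> \<le> b s\<close> and \<open>d \<gamma>\<^sup>2 \<le> b \<kappa>\<close>.\<close>

lemma balanced_step_size_bound:
  fixes b c d L s \<kappa> \<gamma> :: real
  assumes "0 < b" "0 \<le> c" "0 < L" and s: "s = sqrt (c / b)" and \<kappa>: "0
    \<le> \<kappa>" "\<kappa> ^ 3 = d / b"
    and \<gamma>: "\<gamma> = 1 / (2 * L + s + \<kappa>)"
  shows "b / \<gamma> + c * \<gamma> + d * \<gamma>\<^sup>2 \<le> 2 * L * b + 2 * b * s + 2 * b * \<kappa>"
proof -
  have "0 \<le> s"
    using assms by (simp add: s)
  then have den: "0 < 2 * L + s + \<kappa>"
    using \<open>0 < L\<close> \<kappa>(1) by simp
  then have "0 < \<gamma>" "s * \<gamma> \<le> 1" "\<kappa> * \<gamma> \<le> 1"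
    using \<open>0 < L\<close> \<open>0 \<le> s\<close> \<kappa>(1) by (simp_all add: \<gamma> field_simps)
  have "c * \<gamma> = b * s * (s * \<gamma>)"
    using assms by (simp add: s power2_eq_square[symmetric] algebra_simps)
  also have "\<dots> \<le> b * s"
    using \<open>s * \<gamma> \<le> 1\<close> \<open>0 < b\<close> \<open>0 \<le> s\<close>
      by (simp add: mult_left_le)
  finally have c: "c * \<gamma> \<le> b * s" .
  have "d * \<gamma>\<^sup>2 = b * \<kappa> * (\<kappa> * \<gamma>)\<^sup>2"
    using \<kappa>(2) \<open>0 < b\<close> by (simp add: field_simps power2_eq_square power3_eq_cube)
  also have "\<dots> \<le> b * \<kappa>"
    using \<open>\<kappa> * \<gamma> \<le> 1\<close> \<open>0 < \<gamma>\<close> \<open>0 < b\<close>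
      \<kappa>(1) by (simp add: mult_left_le power_le_one)
  finally have d: "d * \<gamma>\<^sup>2 \<le> b * \<kappa>" .
  have "b / \<gamma> = b * (2 * L + s + \<kappa>)"
    using den by (simp add: \<gamma>)
  then show ?thesis
    using c d by (simp add: algebra_simps)
qed

lemma total_lag_weight_le:
  fixes \<delta> \<mu> :: real
  assumes "0 < \<delta>" "\<delta> \<le> 1" "1 \<le> \<tau>" "\<mu> < 1"
  shows "total_lag_weight \<tau> \<delta> \<mu> \<le> 3 * real \<tau> / (\<delta> * (1 - \<mu>))"
proof -
  have "sqrt (1 - \<delta>) \<le> sqrt ((1 - \<delta> / 2)\<^sup>2)"
    by (rule real_sqrt_le_mono) (simp add: power2_eq_square algebra_simps)
  then have "sqrt (1 - \<delta>) \<le> 1 - \<delta> / 2"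
    using assms by simp
  then have "real \<tau> / (1 - sqrt (1 - \<delta>)) \<le> real \<tau> / (\<delta> / 2)"
    using \<open>0 < \<delta>\<close> by (intro divide_left_mono) auto
  moreover have "1 \<le> real \<tau> / \<delta>"
    using assms by (simp add: le_divide_eq)
  ultimately have "1 + real \<tau> / (1 - sqrt (1 - \<delta>)) \<le> 3 * real \<tau> / \<delta>"
    by simp
  then have "(1 + real \<tau> / (1 - sqrt (1 - \<delta>))) / (1 - \<mu>)
    \<le> (3 * real \<tau> / \<delta>) / (1 - \<mu>)"
    using assms by (intro divide_right_mono) auto
  then show ?thesis
    by (simp add: total_lag_weight_def)
qed

lemma le_cube_root_bound:
  fixes x Y T \<delta> \<mu> :: real
  assumes "0 \<le> x" "0 \<le> Y" "0 < T" "0 < \<delta>" "\<mu> < 1"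
    and "x ^ 3 \<le> 216 * 274 * Y\<^sup>2 / (T\<^sup>2 * \<delta>\<^sup>2 * (1 - \<mu>)\<^sup>2)"
  shows "x \<le> 6 * 274 powr (1/3) * Y powr (2/3)
    / (T powr (2/3) * \<delta> powr (2/3) * (1 - \<mu>) powr (2/3))"
proof -
  let ?R = "6 * 274 powr (1/3) * Y powr (2/3)
    / (T powr (2/3) * \<delta> powr (2/3) * (1 - \<mu>) powr (2/3))"
  have "?R ^ 3 = 6 ^ 3 * (274 powr (1/3)) ^ 3 * (Y powr (2/3)) ^ 3
      / ((T powr (2/3)) ^ 3 * (\<delta> powr (2/3)) ^ 3 * ((1 - \<mu>) powr (2/3)) ^ 3)"
    by (simp add: power_mult_distrib power_divide)
  also have "\<dots> = 216 * 274 * Y\<^sup>2 / (T\<^sup>2 * \<delta>\<^sup>2 * (1 - \<mu>)\<^sup>2)"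
    using assms by (simp add: powr_one_third_cube powr_two_thirds_cube)
  finally have "x ^ Suc 2 \<le> ?R ^ Suc 2"
    using assms(6) by (simp add: numeral_3_eq_3[symmetric])
  then show ?thesis
    by (rule power_le_imp_le_base) simp
qed

definition convergence_rate :: "real \<Rightarrow> real \<Rightarrow> real \<Rightarrow> real
  \<Rightarrow> nat \<Rightarrow> nat \<Rightarrow> nat \<Rightarrow> real \<Rightarrow> real
  \<Rightarrow> real" where
  "convergence_rate L \<sigma> \<omega> \<Delta> N T \<tau> \<delta> \<mu> =
    sqrt (32 * L * \<sigma>\<^sup>2 * \<Delta> / (real N * real T)) + 8 * L * \<Delta> / real T
    + 6 * 274 powr (1/3) * (L * real \<tau> * sqrt (\<sigma>\<^sup>2 + \<omega>\<^sup>2) * \<Delta>)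
      powr (2/3)
      / (real T powr (2/3) * \<delta> powr (2/3) * (1 - \<mu>) powr (2/3))"

lemma step_size_choice:
  fixes L \<Delta> \<sigma> \<omega> \<mu> \<delta> :: real and N T \<tau> :: nat
  assumes "0 < L" "0 < \<Delta>" "1 \<le> N" "1 \<le> T" "1
    \<le> \<tau>" "\<mu> < 1" "0 < \<delta>" "\<delta> \<le> 1"
  obtains \<gamma> where "0 < \<gamma>" "L * \<gamma> \<le> 1 / 2"
    "4 * \<Delta> / (\<gamma> * real T) + 2 * L\<^sup>2 * \<gamma>\<^sup>2
      * (total_lag_weight \<tau> \<delta> \<mu>)\<^sup>2 * (\<sigma>\<^sup>2 + \<omega>\<^sup>2)
      + 2 * L * \<gamma> * \<sigma>\<^sup>2 / real N
        \<le> convergence_rate L \<sigma> \<omega> \<Delta> N T \<tau> \<delta> \<mu>"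
proof -
  define b where "b = 4 * \<Delta> / real T"
  define c where "c = 2 * L * \<sigma>\<^sup>2 / real N"
  define d where "d = 2 * L\<^sup>2 * (3 * real \<tau> / (\<delta> * (1 - \<mu>)))\<^sup>2
    * (\<sigma>\<^sup>2 + \<omega>\<^sup>2)"
  define \<kappa> where "\<kappa> = (d / b) powr (1/3)"
  define \<gamma> where "\<gamma> = 1 / (2 * L + sqrt (c / b) + \<kappa>)"
  have b: "0 < b" and c: "0 \<le> c" and d: "0 \<le> d" and \<kappa>: "0 \<le> \<kappa>" "\<kappa> ^ 3
    = d / b"
    using assms by (simp_all add: b_def c_def d_def \<kappa>_def powr_one_third_cube)
  have "0 < 2 * L + sqrt (c / b) + \<kappa>"
    using assms b c \<kappa> by (simp add: add_pos_nonneg)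
  then have step: "0 < \<gamma>" "L * \<gamma> \<le> 1 / 2"
    using assms b c \<kappa> by (simp_all add: \<gamma>_def field_simps)
  have third: "2 * L\<^sup>2 * \<gamma>\<^sup>2 * (total_lag_weight \<tau> \<delta> \<mu>)\<^sup>2
    * (\<sigma>\<^sup>2 + \<omega>\<^sup>2) \<le> d * \<gamma>\<^sup>2"
  proof -
    have "0 \<le> total_lag_weight \<tau> \<delta> \<mu>" "total_lag_weight \<tau> \<delta> \<mu>
      \<le> 3 * real \<tau> / (\<delta> * (1 - \<mu>))"
      using assms total_lag_weight_le[of \<delta> \<tau> \<mu>] by (simp_all add: total_lag_weight_def)
    then have "(total_lag_weight \<tau> \<delta> \<mu>)\<^sup>2
      \<le> (3 * real \<tau> / (\<delta> * (1 - \<mu>)))\<^sup>2"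
      by (intro power_mono)
    then have "2 * L\<^sup>2 * \<gamma>\<^sup>2 * (\<sigma>\<^sup>2 + \<omega>\<^sup>2)
      * (total_lag_weight \<tau> \<delta> \<mu>)\<^sup>2
        \<le> 2 * L\<^sup>2 * \<gamma>\<^sup>2 * (\<sigma>\<^sup>2 + \<omega>\<^sup>2)
          * (3 * real \<tau> / (\<delta> * (1 - \<mu>)))\<^sup>2"
      by (intro mult_left_mono) auto
    then show ?thesis
      unfolding d_def by (simp add: algebra_simps)
  qed
  have balanced: "4 * \<Delta> / (\<gamma> * real T) + d * \<gamma>\<^sup>2 + 2 * L * \<gamma>
    * \<sigma>\<^sup>2 / real N
      \<le> 2 * L * b + 2 * b * sqrt (c / b) + 2 * b * \<kappa>"
    using balanced_step_size_bound[OF b c \<open>0 < L\<close> refl \<kappa> \<gamma>_def]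
      by (simp add: b_def c_def mult_ac add_ac)
  have sqrt_term: "2 * b * sqrt (c / b) = sqrt (32 * L * \<sigma>\<^sup>2 * \<Delta> / (real N * real T))"
  proof -
    have "2 * b * sqrt (c / b) = sqrt ((2 * b)\<^sup>2) * sqrt (c / b)"
      using b by (simp only: real_sqrt_abs abs_of_pos mult_pos_pos zero_less_numeral)
    also have "\<dots> = sqrt ((2 * b)\<^sup>2 * (c / b))"
      by (rule real_sqrt_mult[symmetric])
    also have "(2 * b)\<^sup>2 * (c / b) = 32 * L * \<sigma>\<^sup>2 * \<Delta> / (real N * real T)"
      using b by (simp add: b_def c_def power2_eq_square field_simps)
    finally show ?thesis .
  qed
  have "2 * b * \<kappa> \<le> 6 * 274 powr (1/3)
    * (L * real \<tau> * sqrt (\<sigma>\<^sup>2 + \<omega>\<^sup>2) * \<Delta>) powr (2/3)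
      / (real T powr (2/3) * \<delta> powr (2/3) * (1 - \<mu>) powr (2/3))"
  proof (rule le_cube_root_bound)
    have "(2 * b * \<kappa>) ^ 3 = 8 * b ^ 3 * (d / b)"
      by (simp add: power_mult_distrib \<kappa>(2))
    also have "\<dots> = 8 * b\<^sup>2 * d"
      using b by (simp add: power2_eq_square power3_eq_cube)
    also have "\<dots> = 2304 * (L * real \<tau> * sqrt (\<sigma>\<^sup>2 + \<omega>\<^sup>2)
      * \<Delta>)\<^sup>2 / ((real T)\<^sup>2 * \<delta>\<^sup>2 * (1 - \<mu>)\<^sup>2)"
      using assms by (simp add: b_def d_def power2_eq_square field_simps)
    also have "\<dots> \<le> 216 * 274 * (L * real \<tau> * sqrt (\<sigma>\<^sup>2 + \<omega>\<^sup>2)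
      * \<Delta>)\<^sup>2 / ((real T)\<^sup>2 * \<delta>\<^sup>2 * (1 - \<mu>)\<^sup>2)"
      by (intro divide_right_mono mult_right_mono) auto
    finally show "(2 * b * \<kappa>) ^ 3 \<le> \<dots>" .
  qed (use assms b \<kappa> in auto)
  moreover have "2 * L * b = 8 * L * \<Delta> / real T"
    by (simp add: b_def)
  ultimately have "4 * \<Delta> / (\<gamma> * real T) + 2 * L\<^sup>2 * \<gamma>\<^sup>2
    * (total_lag_weight \<tau> \<delta> \<mu>)\<^sup>2 * (\<sigma>\<^sup>2 + \<omega>\<^sup>2)
      + 2 * L * \<gamma> * \<sigma>\<^sup>2 / real N
        \<le> convergence_rate L \<sigma> \<omega> \<Delta> N T \<tau> \<delta> \<mu>"
    using third balanced sqrt_term unfolding convergence_rate_def by linarith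
  with step show thesis
    by (rule that)
qed

theorem theorem2:
  fixes f :: "real^('n::{finite,wellorder})^('m::{finite,wellorder}) \<Rightarrow> real"
    and grad_f :: "real^('n::{finite,wellorder})^('m::{finite,wellorder}) \<Rightarrow> real^('n::{finite,wellorder})^('m::{finite,wellorder})"
    and fi :: "nat \<Rightarrow> real^('n::{finite,wellorder})^('m::{finite,wellorder}) \<Rightarrow> real"
    and grad_fi :: "nat \<Rightarrow> real^('n::{finite,wellorder})^('m::{finite,wellorder}) \<Rightarrow> real^('n::{finite,wellorder})^('m::{finite,wellorder})"
    and F :: "real^('n::{finite,wellorder})^('m::{finite,wellorder}) \<Rightarrow> 'b \<Rightarrow> real"
    and gF :: "real^('n::{finite,wellorder})^('m::{finite,wellorder}) \<Rightarrow> 'b \<Rightarrow> real^('n::{finite,wellorder})^('m::{finite,wellorder})"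
    and D :: "nat \<Rightarrow> 'b measure"
    and L \<sigma> \<omega> \<mu> :: real
    and N T \<tau> :: nat
    and X0 :: "real^('n::{finite,wellorder})^('m::{finite,wellorder})"
  assumes dims: "CARD('n::{finite,wellorder}) \<le> CARD('m::{finite,wellorder})" "1 \<le> CARD('r::{finite,wellorder})" "CARD('r::{finite,wellorder}) \<le> CARD('n::{finite,wellorder})"
    and mu: "0 \<le> \<mu>" "\<mu> < 1"
    and tau: "1 \<le> \<tau>"
    and nodes: "1 \<le> N"
    and horizon: "1 \<le> T"
    (* (A1) *)
    and f_below: "bdd_below (range f)"
    and f_grad: "\<And>X. (f has_derivative (\<lambda>H. grad_f X \<bullet> H)) (at X)"
    and f_smooth: "\<And>X Y. norm (grad_f X - grad_f Y) \<le> L * norm (X - Y)"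
    (* problem structure *)
    and f_avg: "\<And>X. f X = (\<Sum>i<N. fi i X) / real N"
    and fi_grad: "\<And>i X. i < N \<Longrightarrow> (fi i has_derivative (\<lambda>H. grad_fi i X \<bullet> H)) (at X)"
    and D_prob: "\<And>i. i < N \<Longrightarrow> prob_space (D i)"
    and fi_exp: "\<And>i X. i < N \<Longrightarrow> integrable (D i) (F X) \<and> fi i X = (\<integral>z. F X z \<partial>D i)"
    and F_grad: "\<And>X z. ((\<lambda>Y. F Y z) has_derivative (\<lambda>H. gF X z \<bullet> H)) (at X)"
    and gF_meas: "\<And>i. i < N \<Longrightarrow> (\<lambda>(X, z). gF X z) \<in> borel_measurable (borel \<Otimes>\<^sub>M D i)"
    (* (A2) *)
    and unbiased: "\<And>i X. i < N \<Longrightarrow> integrable (D i) (gF X) \<and> (\<integral>z. gF X z \<partial>D i) = grad_fi i X"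
    and variance: "\<And>i X. i < N \<Longrightarrow>
        (\<integral>\<^sup>+z. ennreal ((norm (gF X z - grad_fi i X))\<^sup>2) \<partial>D i) \<le> ennreal (\<sigma>\<^sup>2)"
    (* (A3) *)
    and grad_bound: "\<And>X. (norm (grad_f X))\<^sup>2 \<le> \<omega>\<^sup>2"
    and second_moment: "\<And>X. (\<integral>\<^sup>+z. ennreal ((norm ((1 / real N) *\<^sub>R (\<Sum>i<N. gF X (z i))))\<^sup>2)
        \<partial>(PiM {..<N} D)) \<le> ennreal (\<sigma>\<^sup>2 + \<omega>\<^sup>2)"
    (* nondegeneracy, see NOTES *)
    and gap_pos: "f X0 > (INF X. f X)"
  shows "\<exists>\<eta>>0. \<forall>(M :: 'a measure) (\<xi> :: nat \<Rightarrow> nat \<Rightarrow> 'a \<Rightarrow> 'b)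
            (qr :: real^('r::{finite,wellorder})^('m::{finite,wellorder}) \<Rightarrow> real^('r::{finite,wellorder})^('m::{finite,wellorder})) (svd :: real^('n::{finite,wellorder})^('m::{finite,wellorder}) \<Rightarrow> real^('r::{finite,wellorder})^('m::{finite,wellorder}))
            (Q0 :: real^('r::{finite,wellorder})^('n::{finite,wellorder})).
         prob_space M
         \<and> (\<forall>t. \<forall>i<N. \<xi> t i \<in> measurable M (D i) \<and> distr M (D i) (\<xi> t i) = D i)
         \<and> prob_space.indep_vars M (\<lambda>(t, i). D i) (\<lambda>(t, i). \<xi> t i) (UNIV \<times> {..<N})
         \<and> (\<forall>A. is_econ_QR A (qr A)) \<and> (\<forall>A. is_top_left_sv A (svd A))
         \<and> qr \<in> borel_measurable borel \<and> svd \<in> borel_measurable borel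
         \<longrightarrow>
         (\<Sum>t<T. \<integral>w. (norm (grad_f (psgd_X qr svd \<tau> \<eta> \<mu> N gF X0 Q0 (\<lambda>t i. \<xi> t i w) t)))\<^sup>2 \<partial>M)
           / real T
         \<le> sqrt (32 * L * \<sigma>\<^sup>2 * (f X0 - (INF X. f X)) / (real N * real T))
           + 8 * L * (f X0 - (INF X. f X)) / real T
           + 6 * 274 powr (1/3)
               * (L * real \<tau> * sqrt (\<sigma>\<^sup>2 + \<omega>\<^sup>2) * (f X0 - (INF X. f X))) powr (2/3)
             / (real T powr (2/3) * (real CARD('r::{finite,wellorder}) / real CARD('n::{finite,wellorder})) powr (2/3)
                * (1 - \<mu>) powr (2/3))"
proof -
  define \<Delta> where "\<Delta> = f X0 - (INF X. f X)"
  have "0 < \<Delta>"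
    using gap_pos by (simp add: \<Delta>_def)
  have f_gap: "f X0 - f X \<le> \<Delta>" for X
    using cINF_lower[OF f_below, of X] by (simp add: \<Delta>_def)
  have grad_bounded: "norm (grad_f X) \<le> \<bar>\<omega>\<bar>" for X
    using grad_bound[of X] power2_le_imp_le[of "norm (grad_f X)" "\<bar>\<omega>\<bar>"] by simp
  show ?thesis
  proof (cases "L = 0")
    case True
    then have "grad_f X = 0" for X
      using f_smooth by (intro const_gradient_bounded_below_eq_0[OF f_grad _ f_below]) simp
    then show ?thesis
      using True by (intro exI[of _ 1]) simp
  next
    case False
    then have "0 < L"
      using Lipschitz_constant_nonneg[OF f_smooth] by simp
    moreover have "0 < real CARD('r) / real CARD('n)" "real CARD('r) / real CARD('n) \<le> 1"
      using dims by simp_all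
    ultimately obtain \<gamma> where \<gamma>: "0 < \<gamma>" "L * \<gamma> \<le> 1 / 2"
      and bound: "4 * \<Delta> / (\<gamma> * real T) + 2 * L\<^sup>2 * \<gamma>\<^sup>2
        * (total_lag_weight \<tau> (real CARD('r) / real CARD('n)) \<mu>)\<^sup>2
          * (\<sigma>\<^sup>2 + \<omega>\<^sup>2) + 2 * L * \<gamma> * \<sigma>\<^sup>2 / real N
        \<le> convergence_rate L \<sigma> \<omega> \<Delta> N T \<tau> (real CARD('r) / real CARD('n))
          \<mu>"
      using step_size_choice \<open>0 < \<Delta>\<close> nodes horizon tau mu(2) by blast
    show ?thesis
    proof (intro exI[of _ "\<gamma> * (1 - \<mu>)"] conjI allI impI, goal_cases)
      case 1
      then show ?case
        using \<gamma> mu by simp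
    next
      case (2 M \<xi> qr svd Q0)
      interpret powersgd_sampling qr svd \<tau> "\<gamma>
        * (1 - \<mu>)" \<mu> N gF X0 Q0 M \<xi> D grad_fi grad_f "\<sigma>\<^sup>2" "\<sigma>\<^sup>2
        + \<omega>\<^sup>2"
        using 2 dims mu tau nodes D_prob gF_meas unbiased variance second_moment
        by (intro powersgd_sampling.intro powersgd.intro powersgd_sampling_axioms.intro
            gradient_of_average[OF f_grad f_avg fi_grad] Lipschitz_borel_measurable[OF f_smooth]) auto
      show ?case
        using average_grad_norm_le[OF f_grad f_smooth f_gap grad_bounded refl refl \<gamma> _ horizon,
            unfolded sample_path_def] \<open>0 < L\<close> bound
        unfolding psgd_X_eq_iterate \<Delta>_def[symmetric] convergence_rate_def by linarith
    qed
  qed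
qed

end
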